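(* Suppose a scaled likelihood-coin oracle with known factor $c\in(0,1]$ is available, i.e. when queried at $q\in\mathbb X$ it returns a Bernoulli variable with success probability $cL(q;y)$, repeated queries using independent auxiliary randomness. For any $\gamma>0$ let $\Xi_\gamma=\sum_{i=1}^{M_\gamma}\delta_{Q_i}$ be a Poisson point process on $\mathbb X$ with intensity measure $\frac{\gamma}{c}\mu_0$. Conditional on $\Xi_\gamma$, query the oracle independently at each atom $Q_i$ and denote the resulting Bernoulli mark by $C_i$, so that $\mathbb P(C_i=1\mid Q_i)=cL(Q_i;y)$. Define the retained point process $\eta_\gamma:=\sum_{i=1}^{M_\gamma}C_i\,\delta_{Q_i}$. Then $\eta_\gamma$ is a Poisson point process with intensity measure $\gamma\nu^y$. Consequently $N_\gamma:=\eta_\gamma(\mathbb X)\sim\operatorname{Poisson}(\gamma Z(y))$, and, conditional on $N_\gamma=k\ge1$, \[ \eta_\gamma\mid\{N_\gamma=k\}\overset{d}{=}\sum_{i=1}^k\delta_{Q_i^\star},\qquad Q_i^\star\stackrel{\rm iid}{\sim}\mu^y . \] Moreover, $\widehat Z_\gamma=N_\gamma/\gamma$ is unbiased for $Z(y)$, with $\operatorname{Var}(\widehat Z_\gamma)=Z(y)/\gamma$.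
   Context: $(\mathbb X,\mathcal X)$ is a measurable space, $\mu_0$ is a (prior) probability measure on it, and for fixed data $y$ the reduced likelihood $L(\cdot\,;y):\mathbb X\to[0,1]$ is measurable with $0<Z(y):=\int_{\mathbb X}L(q;y)\,\mathrm d\mu_0(q)<\infty$. Define the measure $\nu^y$ by $\mathrm d\nu^y(q)=L(q;y)\,\mathrm d\mu_0(q)$ and the posterior probability measure $\mu^y$ by $\frac{\mathrm d\mu^y}{\mathrm d\mu_0}(q)=L(q;y)/Z(y)$. A Poisson point process with finite intensity measure $\Lambda$ is a random counting measure $\Xi$ such that for pairwise disjoint measurable $A_1,\dots,A_m$ the counts $\Xi(A_1),\dots,\Xi(A_m)$ are independent with $\Xi(A_j)\sim\operatorname{Poisson}(\Lambda(A_j))$; equivalently it is generated by $N\sim\operatorname{Poisson}(\Lambda(\mathbb X))$ atoms that are, given $N$, iid with law $\Lambda/\Lambda(\mathbb X)$ (and this is how its atoms $Q_i$ are represented). *)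

theory Defs
  imports "HOL-Probability.Probability"
begin

section \<open>Point processes\<close>

text \<open>Counting measures take finite integer values on all measurable sets; only
  point processes with finite intensity occur here. As for \<^const>\<open>subprob_algebra\<close>, the
  \<open>\<sigma>\<close>-algebra on them is the one generated by the evaluations at measurable sets.\<close>

definition counting_measures :: "'a measure \<Rightarrow> 'a measure set" where
  "counting_measures M =
     {\<xi>. sets \<xi> = sets M \<and> (\<forall>A\<in>sets M. \<exists>n::nat. emeasure \<xi> A = of_nat n)}"

definition counting_algebra :: "'a measure \<Rightarrow> 'a measure measure" where
  "counting_algebra M =
     (SUP A \<in> sets M. vimage_algebra (counting_measures M) (\<lambda>\<xi>. emeasure \<xi> A) borel)"

text \<open>The measure \<open>w\<^sub>0 \<delta>\<^bsub>x\<^sub>0\<^esub> + \<dots> + w\<^bsub>n-1\<^esub> \<delta>\<^bsub>x\<^bsub>n-1\<^esub>\<^esub>\<close>; atoms are numbered from 0.\<close>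

definition dirac_sum :: "'a measure \<Rightarrow> nat \<Rightarrow> (nat \<Rightarrow> ennreal) \<Rightarrow> (nat \<Rightarrow> 'a) \<Rightarrow> 'a measure" where
  "dirac_sum M n w x =
     measure_of (space M) (sets M) (\<lambda>A. \<Sum>i<n. w i * emeasure (return M (x i)) A)"

text \<open>\<^const>\<open>poisson_pmf\<close> is only specified for positive rates, but a measurable set may have
  intensity 0; Poisson(0) is the point mass at 0.\<close>

definition poisson_law :: "real \<Rightarrow> nat pmf" where
  "poisson_law r = (if r = 0 then return_pmf 0 else poisson_pmf r)"

definition real_poisson_law :: "real \<Rightarrow> real measure" where
  "real_poisson_law r = distr (measure_pmf (poisson_law r)) borel real"

definition poisson_point_process ::
    "'w measure \<Rightarrow> 'a measure \<Rightarrow> ('w \<Rightarrow> 'a measure) \<Rightarrow> bool" where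
  "poisson_point_process P \<Lambda> \<Xi> \<longleftrightarrow>
     prob_space P \<and> finite_measure \<Lambda> \<and> \<Xi> \<in> P \<rightarrow>\<^sub>M counting_algebra \<Lambda> \<and>
     (\<forall>m (A :: nat \<Rightarrow> 'a set).
        (\<forall>j<m. A j \<in> sets \<Lambda>) \<and> disjoint_family_on A {..<m} \<longrightarrow>
          prob_space.indep_vars P (\<lambda>_. borel) (\<lambda>j \<omega>. measure (\<Xi> \<omega>) (A j)) {..<m} \<and>
          (\<forall>j<m. distr P borel (\<lambda>\<omega>. measure (\<Xi> \<omega>) (A j)) = real_poisson_law (measure \<Lambda> (A j))))"

text \<open>The usual generation of the atoms: \<open>N\<close> is Poisson with mean \<open>\<Lambda>(X)\<close> and, given \<open>N = n\<close>,
  the atoms \<open>Q\<^sub>0, \<dots>, Q\<^bsub>n-1\<^esub>\<close> are iid with law \<open>\<Lambda>/\<Lambda>(X)\<close>. Nothing is assumed about the law of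
  the \<open>Q\<^sub>i\<close> with \<open>i \<ge> N\<close>, which are not atoms of the process.\<close>

definition poisson_atoms ::
    "'w measure \<Rightarrow> 'a measure \<Rightarrow> ('w \<Rightarrow> nat) \<Rightarrow> (nat \<Rightarrow> 'w \<Rightarrow> 'a) \<Rightarrow> bool" where
  "poisson_atoms P \<Lambda> N Q \<longleftrightarrow>
     N \<in> P \<rightarrow>\<^sub>M count_space UNIV \<and> (\<forall>i. Q i \<in> P \<rightarrow>\<^sub>M \<Lambda>) \<and>
     distr P (count_space UNIV) N = measure_pmf (poisson_law (measure \<Lambda> (space \<Lambda>))) \<and>
     (\<forall>n. measure P {\<omega>\<in>space P. N \<omega> = n} > 0 \<longrightarrow>
        (let P\<^sub>n = uniform_measure P {\<omega>\<in>space P. N \<omega> = n} in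
           prob_space.indep_vars P\<^sub>n (\<lambda>_. \<Lambda>) Q {..<n} \<and>
           (\<forall>i<n. distr P\<^sub>n \<Lambda> (Q i) = scale_measure (inverse (emeasure \<Lambda> (space \<Lambda>))) \<Lambda>)))"


section \<open>The likelihood coin and the marks it produces\<close>

text \<open>The oracle is given by \<open>coin\<close>, the law of its answer to a query at each point.\<close>

definition scaled_coin_oracle ::
    "'a measure \<Rightarrow> real \<Rightarrow> ('a \<Rightarrow> real) \<Rightarrow> ('a \<Rightarrow> bool pmf) \<Rightarrow> bool" where
  "scaled_coin_oracle M c l coin \<longleftrightarrow>
     0 < c \<and> c \<le> 1 \<and> (\<forall>q\<in>space M. coin q = bernoulli_pmf (c * l q))"

text \<open>The information in the number of atoms \<open>N\<close> and the atoms \<open>Q\<^sub>i\<close>, \<open>i < N\<close>.\<close>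

definition atom_algebra ::
    "'w measure \<Rightarrow> 'a measure \<Rightarrow> ('w \<Rightarrow> nat) \<Rightarrow> (nat \<Rightarrow> 'w \<Rightarrow> 'a) \<Rightarrow> 'w measure" where
  "atom_algebra P M N Q =
     sigma (space P) {{\<omega>\<in>space P. N \<omega> = n \<and> (\<forall>i<n. Q i \<omega> \<in> A i)} | n A. \<forall>i. A i \<in> sets M}"

text \<open>Each atom is queried once and the queries use independent auxiliary randomness: conditionally
  on the atoms, the marks are independent and \<open>C\<^sub>i\<close> has the law of the answer at \<open>Q\<^sub>i\<close>. Here
  \<open>b\<close> is a pattern of answers, of which only the first \<open>N\<close> entries matter.\<close>

definition independent_queries ::
    "'w measure \<Rightarrow> 'a measure \<Rightarrow> ('w \<Rightarrow> nat) \<Rightarrow> (nat \<Rightarrow> 'w \<Rightarrow> 'a) \<Rightarrow> ('a \<Rightarrow> bool pmf) \<Rightarrow>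
      (nat \<Rightarrow> 'w \<Rightarrow> bool) \<Rightarrow> bool" where
  "independent_queries P M N Q coin C \<longleftrightarrow>
     (\<forall>i. C i \<in> P \<rightarrow>\<^sub>M count_space UNIV) \<and>
     (\<forall>b :: nat \<Rightarrow> bool. AE \<omega> in P.
        real_cond_exp P (atom_algebra P M N Q)
          (indicator {\<omega>\<in>space P. \<forall>i<N \<omega>. C i \<omega> = b i}) \<omega>
        = (\<Prod>i<N \<omega>. pmf (coin (Q i \<omega>)) (b i)))"


section \<open>The Bayesian setting\<close>

definition evidence :: "'a measure \<Rightarrow> ('a \<Rightarrow> 'y \<Rightarrow> real) \<Rightarrow> 'y \<Rightarrow> real" where
  "evidence \<mu>\<^sub>0 L y = (\<integral>q. L q y \<partial>\<mu>\<^sub>0)"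

definition unnormalized_posterior :: "'a measure \<Rightarrow> ('a \<Rightarrow> 'y \<Rightarrow> real) \<Rightarrow> 'y \<Rightarrow> 'a measure" where
  "unnormalized_posterior \<mu>\<^sub>0 L y = density \<mu>\<^sub>0 (\<lambda>q. ennreal (L q y))"

definition posterior :: "'a measure \<Rightarrow> ('a \<Rightarrow> 'y \<Rightarrow> real) \<Rightarrow> 'y \<Rightarrow> 'a measure" where
  "posterior \<mu>\<^sub>0 L y = density \<mu>\<^sub>0 (\<lambda>q. ennreal (L q y / evidence \<mu>\<^sub>0 L y))"

end

theory Submission
  imports Defs "HOL-Combinatorics.Multiset_Permutations"
begin

text \<open>
  Give every atom \<open>Q\<^sub>i\<close> its mark \<open>C\<^sub>i\<close>. Conditionally on the number of atoms being \<open>n\<close>, the pairs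
  \<open>(Q\<^sub>i, C\<^sub>i)\<close> are independent and identically distributed, and the law of \<open>Q\<^sub>i\<close> on the event \<open>C\<^sub>i = True\<close>
  has density \<open>c L\<close> with respect to the prior (\<open>marked_atoms_law\<close>). This is the only place where
  conditional expectations enter.

  A Poisson number of independent objects, sorted into finitely many categories, gives independent
  Poisson counts (\<open>poisson_splitting\<close>). With the categories "retained and in \<open>A\<^sub>j\<close>" this says that
  the retained process is Poisson, and its intensity is \<open>\<gamma>/c\<close> times the measure with density \<open>c L\<close>
  (\<open>retained_counts\<close>, \<open>retained_poisson\<close>): the factor \<open>c\<close> cancels. Applied to the whole space it
  gives the law of the number of retained atoms, and the moments of the Poisson distribution give
  mean and variance of the estimator.

  The conditional law is obtained without a uniqueness theorem for laws of point processes. On the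
  event that there are \<open>n\<close> atoms with a given pattern of marks, the retained atoms are independent
  with law proportional to \<open>c L\<close> times the prior, that is, the posterior; their number depends on the
  pattern, but their law does not (\<open>retained_on_mark_pattern\<close>). The event that \<open>k\<close> atoms are retained
  is a countable disjoint union of such events (\<open>retained_given_count\<close>).
\<close>

section \<open>The Poisson distribution\<close>

lemma pmf_poisson_law:
  assumes "0 \<le> r"
  shows "pmf (poisson_law r) k = r ^ k / fact k * exp (- r)"
  using assms by (auto simp: poisson_law_def pmf_return indicator_def power_0_left)

text \<open>Both moments are falling factorial moments: multiplying the Poisson weight at \<open>k + d\<close> by
  \<open>(k + d)! / k!\<close> leaves \<open>r\<^sup>d\<close> times the Poisson weight at \<open>k\<close>, and those weights sum to 1.\<close>

lemma poisson_law_factorial_moments: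
  assumes r: "0 \<le> r"
  shows "has_bochner_integral (measure_pmf (poisson_law r)) real r"
    and "has_bochner_integral (measure_pmf (poisson_law r)) (\<lambda>k. real k * (real k - 1)) (r\<^sup>2)"
proof -
  have falling: "has_bochner_integral (measure_pmf (poisson_law r)) f (r ^ d)"
    if f: "\<And>k. 0 \<le> f k" "\<And>k. k < d \<Longrightarrow> f k = 0" "\<And>k. f (k + d) * fact k = fact (k + d)"
    for f :: "nat \<Rightarrow> real" and d
  proof -
    let ?g = "\<lambda>k. f k * pmf (poisson_law r) k"
    have "(\<lambda>k. r ^ k / fact k) sums exp r"
      using exp_converges[of r] by (simp add: divide_inverse mult.commute)
    then have "(\<lambda>k. r ^ d * exp (- r) * (r ^ k / fact k)) sums (r ^ d * exp (- r) * exp r)"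
      by (rule sums_mult)
    also have "(\<lambda>k. r ^ d * exp (- r) * (r ^ k / fact k)) = (\<lambda>k. ?g (k + d))"
    proof
      fix k
      have "f (k + d) = fact (k + d) / fact k"
        by (simp add: eq_divide_eq f(3))
      then show "r ^ d * exp (- r) * (r ^ k / fact k) = ?g (k + d)"
        using r by (simp add: pmf_poisson_law power_add)
    qed
    also have "r ^ d * exp (- r) * exp r = r ^ d"
      by (simp add: exp_minus)
    finally have sums: "?g sums (r ^ d)"
      using f(2) by (subst (asm) sums_iff_shift) simp
    have "integrable (count_space UNIV) ?g"
      using sums f(1) by (simp add: integrable_count_space_nat_iff sums_iff)
    then have "has_bochner_integral (count_space UNIV) ?g (r ^ d)"
      using sums by (simp add: has_bochner_integral_iff integral_count_space_nat sums_iff)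
    then show ?thesis
      by (simp add: measure_pmf_eq_density has_bochner_integral_density mult.commute)
  qed
  show "has_bochner_integral (measure_pmf (poisson_law r)) real r"
    using falling[of real 1] by simp
  show "has_bochner_integral (measure_pmf (poisson_law r)) (\<lambda>k. real k * (real k - 1)) (r\<^sup>2)"
  proof (rule falling)
    show "0 \<le> real k * (real k - 1)" for k by (cases k) auto
    show "real k * (real k - 1) = 0" if "k < 2" for k using that by (cases k) auto
    show "real (k + 2) * (real (k + 2) - 1) * fact k = fact (k + 2)" for k
      by (simp add: algebra_simps)
  qed
qed

lemma (in prob_space) poisson_mean_variance:
  assumes [measurable]: "X \<in> borel_measurable M"
    and law: "distr M borel X = real_poisson_law r" and r: "0 \<le> r"
  shows "expectation X = r" and "variance X = r"
proof -
  have transfer: "has_bochner_integral M (\<lambda>\<omega>. f (X \<omega>)) z"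
    if "has_bochner_integral (measure_pmf (poisson_law r)) (\<lambda>k. f (real k)) z"
      and [measurable]: "f \<in> borel_measurable borel" for f :: "real \<Rightarrow> real" and z
  proof -
    have "has_bochner_integral (distr M borel X) f z"
      using that(1) unfolding law real_poisson_law_def
      by (simp add: has_bochner_integral_iff integrable_distr_eq integral_distr)
    then show ?thesis
      by (simp add: has_bochner_integral_iff integrable_distr_eq integral_distr)
  qed
  have X: "has_bochner_integral M X r"
    using transfer[of "\<lambda>x. x"] poisson_law_factorial_moments(1)[OF r] by simp
  then show mean: "expectation X = r" by (simp add: has_bochner_integral_iff)
  \<comment> \<open>\<open>X\<^sup>2 = X (X - 1) + X\<close>\<close>
  have "has_bochner_integral M (\<lambda>\<omega>. X \<omega> * (X \<omega> - 1)) (r\<^sup>2)"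
    using transfer[of "\<lambda>x. x * (x - 1)"] poisson_law_factorial_moments(2)[OF r] by simp
  from has_bochner_integral_add[OF this X]
  have "has_bochner_integral M (\<lambda>\<omega>. (X \<omega>)\<^sup>2) (r\<^sup>2 + r)"
    by (simp add: algebra_simps power2_eq_square)
  then show "variance X = r"
    using X by (subst variance_eq) (auto simp: has_bochner_integral_iff)
qed

text \<open>Since \<open>J\<close> contains every
  category that occurs, prescribing the counts \<open>k j\<close> prescribes their sum \<open>n\<close>, hence the value of
  \<open>N\<close>. So the event is a disjoint union over the arrangements of one multiset of categories, all
  equally likely, and their number is the multinomial coefficient. Its numerator \<open>n!\<close> cancels the
  denominator of the Poisson weight at \<open>n\<close>, and what remains is a product over \<open>J\<close>.\<close>

lemma (in prob_space) poisson_splitting: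
  fixes T :: "nat \<Rightarrow> 'a \<Rightarrow> 'j"
  assumes [measurable]: "N \<in> M \<rightarrow>\<^sub>M count_space UNIV" "\<And>i. T i \<in> M \<rightarrow>\<^sub>M count_space UNIV"
    and J: "finite J" "\<And>i \<omega>. \<omega> \<in> space M \<Longrightarrow> T i \<omega> \<in> J"
    and r: "0 \<le> r" and p: "\<And>j. j \<in> J \<Longrightarrow> 0 \<le> p j" "(\<Sum>j\<in>J. p j) = 1"
    and law: "\<And>xs. set xs \<subseteq> J \<Longrightarrow>
      prob {\<omega>\<in>space M. N \<omega> = length xs \<and> (\<forall>i<length xs. T i \<omega> = xs ! i)} =
      pmf (poisson_law r) (length xs) * (\<Prod>i<length xs. p (xs ! i))"
  shows "prob {\<omega>\<in>space M. \<forall>j\<in>J. card {i. i < N \<omega> \<and> T i \<omega> = j} = k j} =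
    (\<Prod>j\<in>J. pmf (poisson_law (r * p j)) (k j))"
proof -
  \<comment> \<open>The multiset of categories with the prescribed counts; \<open>E xs\<close> is the event that the categories
    occur in the order \<open>xs\<close>.\<close>
  define A where "A = (\<Sum>j\<in>J. replicate_mset (k j) j)"
  define n where "n = (\<Sum>j\<in>J. k j)"
  define E where "E xs = {\<omega>\<in>space M. N \<omega> = length xs \<and> (\<forall>i<length xs. T i \<omega> = xs ! i)}" for xs
  have [measurable]: "E xs \<in> sets M" for xs
    unfolding E_def by measurable
  have count_A: "count A j = (if j \<in> J then k j else 0)" for j
    using J(1) by (auto simp: A_def count_sum if_distrib[of "\<lambda>x. x j"] sum.delta' cong: if_cong)
  have size_A: "size A = n"
    by (simp add: A_def n_def size_multiset_sum)
  have set_A: "set_mset A \<subseteq> J"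
    by (auto simp: count_A simp flip: count_greater_zero_iff split: if_splits)
  have "{\<omega>\<in>space M. \<forall>j\<in>J. card {i. i < N \<omega> \<and> T i \<omega> = j} = k j} = (\<Union>xs\<in>permutations_of_multiset A. E xs)"
  proof (intro set_eqI iffI)
    fix \<omega> assume "\<omega> \<in> {\<omega>\<in>space M. \<forall>j\<in>J. card {i. i < N \<omega> \<and> T i \<omega> = j} = k j}"
    then have \<omega>: "\<omega> \<in> space M" "\<And>j. j \<in> J \<Longrightarrow> card {i. i < N \<omega> \<and> T i \<omega> = j} = k j" by auto
    define xs where "xs = map (\<lambda>i. T i \<omega>) [0..<N \<omega>]"
    have "count (mset xs) j = count A j" for j
    proof -
      have "count (mset xs) j = card {i. i < N \<omega> \<and> T i \<omega> = j}"
        unfolding count_mset count_list_eq_length_filter length_filter_conv_card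
        by (intro arg_cong[where f=card]) (auto simp: xs_def)
      also have "\<dots> = count A j"
        using \<omega> J(2)[OF \<omega>(1)] by (auto simp: count_A)
      finally show ?thesis .
    qed
    then have "mset xs = A" by (rule multiset_eqI)
    moreover have "\<omega> \<in> E xs" using \<omega>(1) by (auto simp: E_def xs_def)
    ultimately show "\<omega> \<in> (\<Union>xs\<in>permutations_of_multiset A. E xs)"
      by (auto simp: permutations_of_multiset_def)
  next
    fix \<omega> assume "\<omega> \<in> (\<Union>xs\<in>permutations_of_multiset A. E xs)"
    then obtain xs where xs: "mset xs = A" "\<omega> \<in> E xs"
      by (auto simp: permutations_of_multiset_def)
    have "card {i. i < N \<omega> \<and> T i \<omega> = j} = k j" if "j \<in> J" for j
    proof -
      have "card {i. i < N \<omega> \<and> T i \<omega> = j} = card {i. i < length xs \<and> xs ! i = j}"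
        using xs(2) by (intro arg_cong[where f=card]) (auto simp: E_def)
      also have "\<dots> = count (mset xs) j"
        by (simp add: count_mset count_list_eq_length_filter length_filter_conv_card eq_commute)
      finally show ?thesis using that by (simp add: xs count_A)
    qed
    then show "\<omega> \<in> {\<omega>\<in>space M. \<forall>j\<in>J. card {i. i < N \<omega> \<and> T i \<omega> = j} = k j}"
      using xs(2) by (auto simp: E_def)
  qed
  then have "prob {\<omega>\<in>space M. \<forall>j\<in>J. card {i. i < N \<omega> \<and> T i \<omega> = j} = k j} =
      (\<Sum>xs\<in>permutations_of_multiset A. prob (E xs))"
  proof (simp only:, intro finite_measure_finite_Union)
    show "disjoint_family_on E (permutations_of_multiset A)"
      by (auto simp: disjoint_family_on_def E_def intro!: nth_equalityI)
  qed auto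
  also have "\<dots> = (\<Sum>xs\<in>permutations_of_multiset A.
      pmf (poisson_law r) n * (\<Prod>j\<in>J. p j ^ k j))"
  proof (intro sum.cong refl)
    fix xs assume "xs \<in> permutations_of_multiset A"
    then have xs: "mset xs = A" by (auto simp: permutations_of_multiset_def)
    have len: "length xs = n" using xs size_A by (metis size_mset)
    have "prob (E xs) = pmf (poisson_law r) n * (\<Prod>i<length xs. p (xs ! i))"
      unfolding E_def using law[of xs] set_A xs len by (metis set_mset_mset)
    also have "(\<Prod>i<length xs. p (xs ! i)) = prod_list (map p xs)"
      by (simp add: prod.list_conv_set_nth lessThan_atLeast0)
    also have "\<dots> = prod_mset (image_mset p A)"
      by (simp add: xs[symmetric] flip: prod_mset_prod_list)
    also have "\<dots> = (\<Prod>j\<in>J. p j ^ k j)"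
      using J(1) set_A unfolding image_prod_mset_multiplicity
      by (intro prod.mono_neutral_cong_left) (auto simp: count_A not_in_iff split: if_splits)
    finally show "prob (E xs) = pmf (poisson_law r) n * (\<Prod>j\<in>J. p j ^ k j)" .
  qed
  also have "\<dots> = real (card (permutations_of_multiset A)) * (r ^ n / fact n * exp (- r) * (\<Prod>j\<in>J. p j ^ k j))"
    using r by (simp add: pmf_poisson_law)
  also have "\<dots> = (\<Prod>j\<in>J. r ^ k j) * (\<Prod>j\<in>J. p j ^ k j) / (\<Prod>j\<in>J. fact (k j)) * exp (- r)"
  proof -
    have "(\<Prod>x\<in>set_mset A. fact (count A x)) = (\<Prod>j\<in>J. fact (k j) :: nat)"
      using J(1) set_A by (intro prod.mono_neutral_cong_left) (auto simp: count_A not_in_iff split: if_splits)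
    then have "card (permutations_of_multiset A) * (\<Prod>j\<in>J. fact (k j)) = fact n"
      using card_permutations_of_multiset_aux[of A] by (simp add: size_A)
    from arg_cong[OF this, of real]
    have "real (card (permutations_of_multiset A)) * (\<Prod>j\<in>J. fact (k j)) = fact n"
      by simp
    moreover have "(\<Prod>j\<in>J. fact (k j)) \<noteq> (0::real)" using J(1) by simp
    ultimately show ?thesis by (simp add: power_sum n_def field_simps)
  qed
  also have "exp (- r) = (\<Prod>j\<in>J. exp (- (r * p j)))"
    using p(2) J(1) by (simp add: sum_negf flip: exp_sum sum_distrib_left)
  also have "(\<Prod>j\<in>J. r ^ k j) * (\<Prod>j\<in>J. p j ^ k j) / (\<Prod>j\<in>J. fact (k j)) * (\<Prod>j\<in>J. exp (- (r * p j)))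
      = (\<Prod>j\<in>J. pmf (poisson_law (r * p j)) (k j))"
    using r p(1) by (simp add: pmf_poisson_law power_mult_distrib flip: prod.distrib prod_dividef)
  finally show ?thesis .
qed

text \<open>Vectors of natural numbers indexed by a finite set form a countable set, so a product formula
  at single points identifies the whole joint law with a product measure.\<close>

lemma (in prob_space) indep_vars_nat_of_joint_pmf:
  fixes K :: "'i \<Rightarrow> 'a \<Rightarrow> nat"
  assumes J: "finite J" "J \<noteq> {}"
    and K[measurable]: "\<And>j. j \<in> J \<Longrightarrow> K j \<in> M \<rightarrow>\<^sub>M count_space UNIV"
    and joint: "\<And>k. prob {\<omega>\<in>space M. \<forall>j\<in>J. K j \<omega> = k j} = (\<Prod>j\<in>J. pmf (q j) (k j))"
  shows "indep_vars (\<lambda>_. count_space UNIV) K J"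
    and "\<And>j. j \<in> J \<Longrightarrow> distr M (count_space UNIV) (K j) = measure_pmf (q j)"
proof -
  let ?S = "\<lambda>_::'i. count_space (UNIV :: nat set)"
  let ?X = "\<lambda>\<omega>. \<lambda>j\<in>J. K j \<omega>"
  interpret q: product_prob_space "\<lambda>j. measure_pmf (q j)"
    by (intro product_prob_spaceI measure_pmf.prob_space_axioms)
  have PiM: "PiM J ?S = count_space (PiE J (\<lambda>_. UNIV))"
    using J(1) by (rule count_space_PiM_finite) simp
  have sets_q: "sets (PiM J (\<lambda>j. measure_pmf (q j))) = sets (PiM J ?S)"
    by (intro sets_PiM_cong) simp_all
  have [measurable]: "?X \<in> M \<rightarrow>\<^sub>M PiM J ?S"
    by (intro measurable_restrict K)
  have distr: "distr M (PiM J ?S) ?X = PiM J (\<lambda>j. measure_pmf (q j))"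
  proof (rule measure_eqI_countable)
    show "countable (PiE J (\<lambda>_. UNIV :: nat set))"
      using J(1) by (intro countable_PiE) auto
    show "sets (distr M (PiM J ?S) ?X) = Pow (PiE J (\<lambda>_. UNIV))" by (simp add: PiM)
    show "sets (PiM J (\<lambda>j. measure_pmf (q j))) = Pow (PiE J (\<lambda>_. UNIV))"
      unfolding sets_q by (simp add: PiM)
    fix f :: "'i \<Rightarrow> nat" assume f: "f \<in> PiE J (\<lambda>_. UNIV)"
    have "emeasure (distr M (PiM J ?S) ?X) {f} = emeasure M (?X -` {f} \<inter> space M)"
      using f by (intro emeasure_distr) (measurable, simp add: PiM)
    also have "?X -` {f} \<inter> space M = {\<omega>\<in>space M. \<forall>j\<in>J. K j \<omega> = f j}"
      using f by (auto simp: fun_eq_iff PiE_iff extensional_def)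
    also have "emeasure M \<dots> = (\<Prod>j\<in>J. pmf (q j) (f j))"
      by (simp add: emeasure_eq_measure joint)
    also have "\<dots> = emeasure (PiM J (\<lambda>j. measure_pmf (q j))) (PiE J (\<lambda>j. {f j}))"
      using J(1) by (subst q.emeasure_PiM) (auto simp: emeasure_pmf_single prod_ennreal)
    also have "PiE J (\<lambda>j. {f j}) = {f}"
      using f by (intro PiE_singleton) (simp add: PiE_iff)
    finally show "emeasure (distr M (PiM J ?S) ?X) {f} = emeasure (PiM J (\<lambda>j. measure_pmf (q j))) {f}" .
  qed
  show marg: "distr M (count_space UNIV) (K j) = measure_pmf (q j)" if j: "j \<in> J" for j
  proof -
    have "distr M (count_space UNIV) (K j) = distr M (count_space UNIV) ((\<lambda>f. f j) \<circ> ?X)"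
      using j by (intro distr_cong) auto
    also have "\<dots> = distr (distr M (PiM J ?S) ?X) (count_space UNIV) (\<lambda>f. f j)"
      using j by (intro distr_distr[symmetric] measurable_component_singleton) auto
    also have "\<dots> = distr (PiM J (\<lambda>j. measure_pmf (q j))) (measure_pmf (q j)) (\<lambda>f. f j)"
      unfolding distr by (intro distr_cong) auto
    also have "\<dots> = measure_pmf (q j)"
      using j by (intro distr_PiM_component measure_pmf.prob_space_axioms)
    finally show ?thesis .
  qed
  show "indep_vars (\<lambda>_. count_space UNIV) K J"
    using indep_vars_iff_distr_eq_PiM'[of J K ?S] J(2) K
    by (simp add: distr marg cong: PiM_cong)
qed

section \<open>Sums of point masses as counting measures\<close>

lemma counting_algebra_cong:
  assumes "sets S = sets S'"
  shows "counting_algebra S = counting_algebra S'"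
  using assms by (simp add: counting_algebra_def counting_measures_def)

lemma measurable_counting_algebraI:
  assumes "\<And>\<omega>. \<omega> \<in> space P \<Longrightarrow> f \<omega> \<in> counting_measures S"
    and "\<And>A. A \<in> sets S \<Longrightarrow> (\<lambda>\<omega>. emeasure (f \<omega>) A) \<in> borel_measurable P"
  shows "f \<in> P \<rightarrow>\<^sub>M counting_algebra S"
  unfolding counting_algebra_def
  using assms by (intro measurable_SUP2 measurable_vimage_algebra2) auto

lemma measurable_measure_counting_algebra:
  assumes "A \<in> sets S"
  shows "(\<lambda>\<xi>. measure \<xi> A) \<in> borel_measurable (counting_algebra S)"
proof -
  have [measurable]: "(\<lambda>\<xi>. emeasure \<xi> A) \<in> borel_measurable (counting_algebra S)"
    using assms by (auto intro!: measurable_Sup1 measurable_vimage_algebra1 simp: counting_algebra_def)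
  show ?thesis unfolding measure_def by measurable
qed

lemma sets_dirac_sum [simp]: "sets (dirac_sum S n w x) = sets S"
  by (simp add: dirac_sum_def)

lemma emeasure_dirac_sum:
  assumes A: "A \<in> sets S"
  shows "emeasure (dirac_sum S n w x) A = (\<Sum>i<n. w i * indicator A (x i))"
proof -
  have "emeasure (dirac_sum S n w x) A = (\<Sum>i<n. w i * emeasure (return S (x i)) A)"
  proof (rule emeasure_measure_of[OF dirac_sum_def])
    show "countably_additive (sets (dirac_sum S n w x)) (\<lambda>A. \<Sum>i<n. w i * emeasure (return S (x i)) A)"
    proof (rule countably_additiveI)
      fix A :: "nat \<Rightarrow> 'a set"
      assume A: "range A \<subseteq> sets (dirac_sum S n w x)" "disjoint_family A"
      have "(\<Sum>k. \<Sum>i<n. w i * emeasure (return S (x i)) (A k)) =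
          (\<Sum>i<n. \<Sum>k. w i * emeasure (return S (x i)) (A k))"
        by (rule suminf_sum) auto
      also have "\<dots> = (\<Sum>i<n. w i * emeasure (return S (x i)) (\<Union>k. A k))"
        using A by (simp add: ennreal_suminf_cmult suminf_emeasure del: emeasure_return)
      finally show "(\<Sum>k. \<Sum>i<n. w i * emeasure (return S (x i)) (A k)) =
          (\<Sum>i<n. w i * emeasure (return S (x i)) (\<Union>k. A k))" .
    qed
  qed (use A sets.space_closed in \<open>auto simp: positive_def\<close>)
  then show ?thesis using A by simp
qed

lemma emeasure_dirac_sum_of_bool:
  assumes "A \<in> sets S"
  shows "emeasure (dirac_sum S n (\<lambda>i. of_bool (b i)) x) A = of_nat (card {i. i < n \<and> b i \<and> x i \<in> A})"
proof -
  have "emeasure (dirac_sum S n (\<lambda>i. of_bool (b i)) x) A = (\<Sum>i<n. if b i \<and> x i \<in> A then 1 else 0)"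
    unfolding emeasure_dirac_sum[OF assms] by (intro sum.cong) auto
  also have "\<dots> = of_nat (card {i\<in>{..<n}. b i \<and> x i \<in> A})"
    by (simp add: sum.If_cases Int_def)
  finally show ?thesis by simp
qed

lemma measure_dirac_sum_of_bool:
  assumes "A \<in> sets S"
  shows "measure (dirac_sum S n (\<lambda>i. of_bool (b i)) x) A = real (card {i. i < n \<and> b i \<and> x i \<in> A})"
  by (simp add: measure_def emeasure_dirac_sum_of_bool[OF assms] enn2real_of_nat)

text \<open>Discarding atoms leaves a sum over the kept ones, in any numbering \<open>e\<close>; this turns a thinned
  sum into one of the shape that appears in the conditional law.\<close>

lemma dirac_sum_of_bool_reindex:
  assumes e: "bij_betw e {..<k} {i. i < n \<and> b i}"
  shows "dirac_sum S n (\<lambda>i. of_bool (b i)) x = dirac_sum S k (\<lambda>i. 1) (\<lambda>j. x (e j))"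
proof (rule measure_eqI)
  fix A assume "A \<in> sets (dirac_sum S n (\<lambda>i. of_bool (b i)) x)"
  then have A: "A \<in> sets S" by simp
  have "emeasure (dirac_sum S n (\<lambda>i. of_bool (b i)) x) A = (\<Sum>i\<in>{i. i < n \<and> b i}. indicator A (x i))"
    unfolding emeasure_dirac_sum[OF A] by (intro sum.mono_neutral_cong_right) auto
  also have "\<dots> = (\<Sum>j<k. indicator A (x (e j)))"
    using e by (rule sum.reindex_bij_betw[symmetric])
  also have "\<dots> = emeasure (dirac_sum S k (\<lambda>i. 1) (\<lambda>j. x (e j))) A"
    by (simp add: emeasure_dirac_sum[OF A])
  finally show "emeasure (dirac_sum S n (\<lambda>i. of_bool (b i)) x) A =
      emeasure (dirac_sum S k (\<lambda>i. 1) (\<lambda>j. x (e j))) A" .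
qed simp

lemma dirac_sum_of_bool_in_counting_measures:
  "dirac_sum S n (\<lambda>i. of_bool (b i)) x \<in> counting_measures S"
  by (auto simp: counting_measures_def emeasure_dirac_sum_of_bool)

lemma measurable_dirac_sum_of_bool:
  assumes [measurable]: "N \<in> P \<rightarrow>\<^sub>M count_space UNIV"
    "\<And>i. b i \<in> P \<rightarrow>\<^sub>M count_space UNIV" "\<And>i. x i \<in> P \<rightarrow>\<^sub>M S"
  shows "(\<lambda>\<omega>. dirac_sum S (N \<omega>) (\<lambda>i. of_bool (b i \<omega>)) (\<lambda>i. x i \<omega>)) \<in> P \<rightarrow>\<^sub>M counting_algebra S"
proof (rule measurable_counting_algebraI)
  fix A assume A[measurable]: "A \<in> sets S"
  have "(\<lambda>\<omega>. \<Sum>i<N \<omega>. of_bool (b i \<omega>) * indicator A (x i \<omega>) :: ennreal) \<in> borel_measurable P"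
    by (rule measurable_compose_countable[where f="\<lambda>n \<omega>. \<Sum>i<n. of_bool (b i \<omega>) * indicator A (x i \<omega>)"]) measurable
  then show "(\<lambda>\<omega>. emeasure (dirac_sum S (N \<omega>) (\<lambda>i. of_bool (b i \<omega>)) (\<lambda>i. x i \<omega>)) A) \<in> borel_measurable P"
    by (simp add: emeasure_dirac_sum[OF A])
qed (rule dirac_sum_of_bool_in_counting_measures)

lemma measurable_dirac_sum_PiM:
  "(\<lambda>q. dirac_sum S k (\<lambda>i. 1) q) \<in> (\<Pi>\<^sub>M i\<in>{..<k}. S) \<rightarrow>\<^sub>M counting_algebra S"
proof (rule measurable_counting_algebraI)
  show "dirac_sum S k (\<lambda>i. 1) q \<in> counting_measures S" for q
    using dirac_sum_of_bool_in_counting_measures[of S k "\<lambda>_. True"] by simp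
  fix A assume A[measurable]: "A \<in> sets S"
  show "(\<lambda>q. emeasure (dirac_sum S k (\<lambda>i. 1) q) A) \<in> borel_measurable (\<Pi>\<^sub>M i\<in>{..<k}. S)"
    unfolding emeasure_dirac_sum[OF A] by measurable
qed

section \<open>Densities, conditioning and modification off the sample space\<close>

lemma density_cmult:
  assumes [measurable]: "f \<in> borel_measurable S" and f: "\<And>q. q \<in> space S \<Longrightarrow> 0 \<le> f q" and a: "0 \<le> a"
  shows "density S (\<lambda>q. ennreal (a * f q)) = scale_measure (ennreal a) (density S (\<lambda>q. ennreal (f q)))"
proof (rule measure_eqI)
  fix A assume "A \<in> sets (density S (\<lambda>q. ennreal (a * f q)))"
  then have [measurable]: "A \<in> sets S" by simp
  have "emeasure (density S (\<lambda>q. ennreal (a * f q))) A = (\<integral>\<^sup>+q. ennreal a * (ennreal (f q) * indicator A q) \<partial>S)"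
    using f a by (subst emeasure_density) (auto simp: ennreal_mult mult.assoc intro!: nn_integral_cong)
  also have "\<dots> = ennreal a * (\<integral>\<^sup>+q. ennreal (f q) * indicator A q \<partial>S)"
    by (intro nn_integral_cmult) measurable
  finally show "emeasure (density S (\<lambda>q. ennreal (a * f q))) A =
      emeasure (scale_measure (ennreal a) (density S (\<lambda>q. ennreal (f q)))) A"
    by (simp add: emeasure_density)
qed simp

lemma measure_density_eq_integral:
  fixes f :: "'a \<Rightarrow> real"
  assumes [measurable]: "f \<in> borel_measurable S" "A \<in> sets S" and "\<And>q. 0 \<le> f q"
  shows "measure (density S (\<lambda>q. ennreal (f q))) A = (\<integral>q. indicator A q * f q \<partial>S)"
proof -
  have "measure (density S (\<lambda>q. ennreal (f q))) A = enn2real (\<integral>\<^sup>+q. ennreal (indicator A q * f q) \<partial>S)"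
    unfolding measure_def
    by (subst emeasure_density) (auto intro!: arg_cong[where f=enn2real] nn_integral_cong split: split_indicator)
  also have "\<dots> = (\<integral>q. indicator A q * f q \<partial>S)"
    using assms(3) by (intro integral_eq_nn_integral[symmetric]) auto
  finally show ?thesis .
qed

lemma integral_uniform_measure:
  fixes f :: "'w \<Rightarrow> real"
  assumes "finite_measure P" and [measurable]: "f \<in> borel_measurable P" "B \<in> sets P"
    and B: "measure P B \<noteq> 0"
  shows "(\<integral>\<omega>. f \<omega> \<partial>uniform_measure P B) = (\<integral>\<omega>. indicator B \<omega> * f \<omega> \<partial>P) / measure P B"
proof -
  interpret finite_measure P by fact
  have "uniform_measure P B = density P (\<lambda>\<omega>. ennreal (indicator B \<omega> / measure P B))"
    unfolding uniform_measure_def using B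
    by (intro density_cong AE_I2)
       (auto simp: emeasure_eq_measure divide_ennreal zero_less_measure_iff split: split_indicator
             simp flip: ennreal_1)
  then show ?thesis
    by (simp add: integral_density)
qed

text \<open>Random variables are total functions, and the processes compared here are only known to agree
  on the sample space; so independence has to be transferred between such functions.\<close>

lemma indep_vars_cong_on_space:
  assumes "prob_space P" and eq: "\<And>i \<omega>. i \<in> I \<Longrightarrow> \<omega> \<in> space P \<Longrightarrow> X i \<omega> = Y i \<omega>"
    and X: "prob_space.indep_vars P S X I"
  shows "prob_space.indep_vars P S Y I"
proof -
  interpret prob_space P by fact
  have "X i -` A \<inter> space P = Y i -` A \<inter> space P" if "i \<in> I" for i A
    using eq[OF that] by auto
  moreover have "X i \<in> P \<rightarrow>\<^sub>M S i \<longleftrightarrow> Y i \<in> P \<rightarrow>\<^sub>M S i" if "i \<in> I" for i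
    using eq[OF that] by (intro measurable_cong) auto
  ultimately show ?thesis
    using X unfolding indep_vars_def2 by (simp cong: indep_sets_cong)
qed

lemma poisson_point_process_cong:
  assumes \<Xi>: "poisson_point_process P \<Lambda> \<Xi>" and eq: "\<And>\<omega>. \<omega> \<in> space P \<Longrightarrow> \<Xi> \<omega> = \<Xi>' \<omega>"
  shows "poisson_point_process P \<Lambda> \<Xi>'"
proof -
  have P: "prob_space P" using \<Xi> by (simp add: poisson_point_process_def)
  have "\<Xi>' \<in> P \<rightarrow>\<^sub>M counting_algebra \<Lambda> \<longleftrightarrow> \<Xi> \<in> P \<rightarrow>\<^sub>M counting_algebra \<Lambda>"
    by (intro measurable_cong) (simp add: eq)
  moreover have "distr P borel (\<lambda>\<omega>. measure (\<Xi>' \<omega>) B) = distr P borel (\<lambda>\<omega>. measure (\<Xi> \<omega>) B)" for B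
    by (intro distr_cong) (simp_all add: eq)
  moreover have "prob_space.indep_vars P (\<lambda>_. borel) (\<lambda>j \<omega>. measure (\<Xi>' \<omega>) (A j)) {..<m} \<longleftrightarrow>
      prob_space.indep_vars P (\<lambda>_. borel) (\<lambda>j \<omega>. measure (\<Xi> \<omega>) (A j)) {..<m}" for A :: "nat \<Rightarrow> _" and m :: nat
    by (rule iffI; erule indep_vars_cong_on_space[OF P, rotated]) (simp_all add: eq)
  ultimately show ?thesis
    using \<Xi> unfolding poisson_point_process_def by simp
qed

section \<open>The joint law of atoms and marks\<close>

lemma subalgebra_atom_algebra:
  assumes [measurable]: "N \<in> P \<rightarrow>\<^sub>M count_space UNIV" "\<And>i. Q i \<in> P \<rightarrow>\<^sub>M S"
  shows "subalgebra P (atom_algebra P S N Q)"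
proof -
  let ?G = "{{\<omega>\<in>space P. N \<omega> = n \<and> (\<forall>i<n. Q i \<omega> \<in> A i)} | n A. \<forall>i. A i \<in> sets S}"
  have "?G \<subseteq> sets P"
  proof safe
    fix n and A :: "nat \<Rightarrow> 'b set" assume "\<forall>i. A i \<in> sets S"
    then have [measurable]: "A i \<in> sets S" for i by blast
    show "{\<omega>\<in>space P. N \<omega> = n \<and> (\<forall>i<n. Q i \<omega> \<in> A i)} \<in> sets P" by measurable
  qed
  then have "sigma_sets (space P) ?G \<subseteq> sets P" by (rule sets.sigma_sets_subset)
  moreover have "?G \<subseteq> Pow (space P)" by auto
  ultimately show ?thesis
    by (simp add: subalgebra_def atom_algebra_def)
qed

text \<open>The event is the intersection of an event in the \<open>\<sigma>\<close>-algebra of the atoms with an event about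
  the marks. The defining property of conditional expectation turns its probability into an
  integral over the atoms alone, which factorizes because the atoms are independent given \<open>N = n\<close>.
  So, given \<open>N = n\<close>, the pairs \<open>(Q\<^sub>i, C\<^sub>i)\<close> with \<open>i < n\<close> are independent, and the law of \<open>Q\<^sub>i\<close> on the
  event \<open>C\<^sub>i = b\<close> has the probability of the answer \<open>b\<close> as its density.\<close>

lemma (in prob_space) marked_atoms_law:
  assumes S: "prob_space S" and r: "0 < r"
    and coin[measurable]: "\<And>b. (\<lambda>q. pmf (coin q) b) \<in> borel_measurable S"
    and atoms: "poisson_atoms M (scale_measure (ennreal r) S) N Q"
    and marks: "independent_queries M S N Q coin C"
    and A[measurable]: "\<And>i. A i \<in> sets S"
  shows "prob {\<omega>\<in>space M. N \<omega> = n \<and> (\<forall>i<n. Q i \<omega> \<in> A i \<and> C i \<omega> = b i)} =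
    pmf (poisson_law r) n * (\<Prod>i<n. measure (density S (\<lambda>q. pmf (coin q) (b i))) (A i))"
proof -
  interpret S: prob_space S by fact
  let ?\<Lambda> = "scale_measure (ennreal r) S"
  have N[measurable]: "N \<in> M \<rightarrow>\<^sub>M count_space UNIV"
    and "\<And>i. Q i \<in> M \<rightarrow>\<^sub>M ?\<Lambda>"
    and N_law: "distr M (count_space UNIV) N = measure_pmf (poisson_law r)"
    using atoms r by (simp_all add: poisson_atoms_def space_scale_measure S.prob_space)
  then have Q[measurable]: "\<And>i. Q i \<in> M \<rightarrow>\<^sub>M S" by (simp cong: measurable_cong_sets)
  have C[measurable]: "\<And>i. C i \<in> M \<rightarrow>\<^sub>M count_space UNIV"
    using marks by (simp add: independent_queries_def)
  define B where "B = {\<omega>\<in>space M. N \<omega> = n}"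
  have [measurable]: "B \<in> sets M" unfolding B_def by measurable
  have prob_B: "prob B = pmf (poisson_law r) n"
  proof -
    have "pmf (poisson_law r) n = measure (distr M (count_space UNIV) N) {n}"
      by (simp add: N_law pmf.rep_eq)
    also have "\<dots> = prob B"
      by (subst measure_distr) (auto simp: B_def vimage_def Int_def conj_commute)
    finally show ?thesis by simp
  qed
  have B_pos: "0 < prob B"
    unfolding prob_B using r by (simp add: pmf_poisson_law)

  let ?F = "atom_algebra M S N Q"
  interpret F: finite_measure_subalgebra M ?F
    by unfold_locales (rule subalgebra_atom_algebra; measurable)
  define D where "D = {\<omega>\<in>space M. \<forall>i<N \<omega>. C i \<omega> = b i}"
  define E where "E = {\<omega>\<in>space M. N \<omega> = n \<and> (\<forall>i<n. Q i \<omega> \<in> A i)}"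
  have [measurable]: "D \<in> sets M" "E \<in> sets M" unfolding D_def E_def by measurable
  have E_F: "E \<in> sets ?F"
    unfolding atom_algebra_def
  proof (rule in_measure_of)
    show "E \<in> {{\<omega>\<in>space M. N \<omega> = n \<and> (\<forall>i<n. Q i \<omega> \<in> A i)} | n A. \<forall>i. A i \<in> sets S}"
      unfolding E_def using A by blast
  qed auto
  define h where "h i q = indicator (A i) q * pmf (coin q) (b i)" for i q
  have h[measurable]: "h i \<in> borel_measurable S" for i unfolding h_def by measurable
  have h_bounds: "\<bar>h i q\<bar> \<le> 1" for i q
    by (simp add: h_def pmf_le_1 split: split_indicator)

  have "prob {\<omega>\<in>space M. N \<omega> = n \<and> (\<forall>i<n. Q i \<omega> \<in> A i \<and> C i \<omega> = b i)} = prob (E \<inter> D)"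
    by (intro arg_cong[where f=prob]) (auto simp: E_def D_def)
  also have "\<dots> = (\<integral>\<omega>\<in>E. indicator D \<omega> \<partial>M)"
    by (simp add: set_lebesgue_integral_def flip: indicator_inter_arith)
  also have "\<dots> = (\<integral>\<omega>\<in>E. real_cond_exp M ?F (indicator D) \<omega> \<partial>M)"
    using E_F by (intro F.real_cond_exp_intA) (auto simp: integrable_indicator_iff emeasure_eq_measure)
  also have "\<dots> = (\<integral>\<omega>. indicator B \<omega> * (\<Prod>i<n. h i (Q i \<omega>)) \<partial>M)"
    unfolding set_lebesgue_integral_def
  proof (rule integral_cong_AE)
    show "AE \<omega> in M. indicator E \<omega> *\<^sub>R real_cond_exp M ?F (indicator D) \<omega> =
        indicator B \<omega> * (\<Prod>i<n. h i (Q i \<omega>))"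
    proof -
      have "AE \<omega> in M. real_cond_exp M ?F (indicator D) \<omega> = (\<Prod>i<N \<omega>. pmf (coin (Q i \<omega>)) (b i))"
        using marks unfolding independent_queries_def D_def by blast
      moreover have "indicator E \<omega> * (\<Prod>i<N \<omega>. pmf (coin (Q i \<omega>)) (b i)) =
          indicator B \<omega> * (\<Prod>i<n. h i (Q i \<omega>))" for \<omega>
      proof -
        have "(\<Prod>i<n. indicator (A i) (Q i \<omega>) :: real) = of_bool (\<forall>i<n. Q i \<omega> \<in> A i)"
          by (auto simp: indicator_def)
        then show ?thesis
          by (auto simp: E_def B_def h_def prod.distrib split: split_indicator)
      qed
      ultimately show ?thesis by (auto elim!: eventually_mono)
    qed
  qed measurable
  also have "\<dots> = prob B * (\<integral>\<omega>. (\<Prod>i<n. h i (Q i \<omega>)) \<partial>uniform_measure M B)"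
    using B_pos by (subst integral_uniform_measure) (auto simp: finite_measure_axioms)
  also have "(\<integral>\<omega>. (\<Prod>i<n. h i (Q i \<omega>)) \<partial>uniform_measure M B) = (\<Prod>i<n. \<integral>q. h i q \<partial>S)"
  proof -
    let ?U = "uniform_measure M B"
    interpret U: prob_space ?U
      using B_pos by (intro prob_space_uniform_measure) (auto simp: emeasure_eq_measure)
    have indep: "U.indep_vars (\<lambda>_. ?\<Lambda>) Q {..<n}"
      and "\<And>i. i < n \<Longrightarrow> distr ?U ?\<Lambda> (Q i) = scale_measure (inverse (emeasure ?\<Lambda> (space ?\<Lambda>))) ?\<Lambda>"
      using atoms B_pos unfolding poisson_atoms_def Let_def B_def by blast+
    moreover have "scale_measure (inverse (emeasure ?\<Lambda> (space ?\<Lambda>))) ?\<Lambda> = S"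
      using r by (simp add: space_scale_measure S.emeasure_space_1 inverse_ennreal flip: ennreal_mult)
    moreover have "distr ?U ?\<Lambda> (Q i) = distr ?U S (Q i)" for i
      by (intro distr_cong) auto
    ultimately have law: "distr ?U S (Q i) = S" if "i < n" for i
      using that by simp
    have "U.indep_vars (\<lambda>_. borel) (\<lambda>i \<omega>. h i (Q i \<omega>)) {..<n}"
      using indep by (rule U.indep_vars_compose2) simp
    then have "(\<integral>\<omega>. (\<Prod>i<n. h i (Q i \<omega>)) \<partial>?U) = (\<Prod>i<n. \<integral>\<omega>. h i (Q i \<omega>) \<partial>?U)"
      by (intro U.indep_vars_lebesgue_integral U.integrable_const_bound[where B=1]) (auto simp: h_bounds)
    also have "\<dots> = (\<Prod>i<n. \<integral>q. h i q \<partial>S)"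
    proof (intro prod.cong refl)
      fix i assume "i \<in> {..<n}"
      then have "(\<integral>q. h i q \<partial>S) = (\<integral>q. h i q \<partial>distr ?U S (Q i))" by (simp add: law)
      also have "\<dots> = (\<integral>\<omega>. h i (Q i \<omega>) \<partial>?U)" by (intro integral_distr) auto
      finally show "(\<integral>\<omega>. h i (Q i \<omega>) \<partial>?U) = (\<integral>q. h i q \<partial>S)" by simp
    qed
    finally show ?thesis .
  qed
  also have "(\<Prod>i<n. \<integral>q. h i q \<partial>S) = (\<Prod>i<n. measure (density S (\<lambda>q. pmf (coin q) (b i))) (A i))"
  proof (intro prod.cong refl)
    fix i
    show "(\<integral>q. h i q \<partial>S) = measure (density S (\<lambda>q. pmf (coin q) (b i))) (A i)"
      by (simp add: h_def measure_density_eq_integral)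
  qed
  finally show ?thesis by (simp add: prob_B)
qed

section \<open>The retained process\<close>

text \<open>The joint law of \<^prop>\<open>N = n\<close>, atoms and marks in the product form just found: \<open>\<kappa> b\<close> is the law of
  an atom restricted to the event that its mark is \<open>b\<close>. This form is all that the law of the
  retained process depends on.\<close>

locale marked_poisson_atoms = prob_space P for P :: "'w measure" +
  fixes S :: "'a measure" and r :: real and \<kappa> :: "bool \<Rightarrow> 'a measure"
    and N :: "'w \<Rightarrow> nat" and Q :: "nat \<Rightarrow> 'w \<Rightarrow> 'a" and C :: "nat \<Rightarrow> 'w \<Rightarrow> bool"
  assumes r: "0 < r"
    and N_measurable[measurable]: "N \<in> P \<rightarrow>\<^sub>M count_space UNIV"
    and Q_measurable[measurable]: "\<And>i. Q i \<in> P \<rightarrow>\<^sub>M S"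
    and C_measurable[measurable]: "\<And>i. C i \<in> P \<rightarrow>\<^sub>M count_space UNIV"
    and sets_\<kappa>[simp]: "\<And>b. sets (\<kappa> b) = sets S"
    and finite_\<kappa>: "\<And>b. finite_measure (\<kappa> b)"
    and total_\<kappa>: "measure (\<kappa> True) (space S) + measure (\<kappa> False) (space S) = 1"
    and law: "\<And>n A b. (\<And>i. A i \<in> sets S) \<Longrightarrow>
      prob {\<omega>\<in>space P. N \<omega> = n \<and> (\<forall>i<n. Q i \<omega> \<in> A i \<and> C i \<omega> = b i)} =
      pmf (poisson_law r) n * (\<Prod>i<n. measure (\<kappa> (b i)) (A i))"
begin

definition retained :: "'w \<Rightarrow> 'a measure" where
  "retained \<omega> = dirac_sum S (N \<omega>) (\<lambda>i. of_bool (C i \<omega>)) (\<lambda>i. Q i \<omega>)"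

lemma measurable_retained[measurable]: "retained \<in> P \<rightarrow>\<^sub>M counting_algebra S"
  unfolding retained_def by (rule measurable_dirac_sum_of_bool) measurable

text \<open>Classify each atom by the set \<open>A j\<close> that it lies in, provided it is retained. Two further
  categories, the retained atoms outside all \<open>A j\<close> and the discarded atoms, make the classification
  exhaustive, as \<open>poisson_splitting\<close> requires. Every category is a rectangle (a set of points with
  one value of the mark), so its probability is a value of \<open>\<kappa>\<close>.\<close>

lemma retained_counts:
  fixes A :: "nat \<Rightarrow> 'a set"
  assumes A: "\<And>j. j < m \<Longrightarrow> A j \<in> sets S" and disj: "disjoint_family_on A {..<m}"
  shows "indep_vars (\<lambda>_. borel) (\<lambda>j \<omega>. measure (retained \<omega>) (A j)) {..<m}"
    and "j < m \<Longrightarrow> distr P borel (\<lambda>\<omega>. measure (retained \<omega>) (A j)) =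
      real_poisson_law (r * measure (\<kappa> True) (A j))"
proof -
  interpret \<kappa>: finite_measure "\<kappa> b" for b by (rule finite_\<kappa>)
  define J where "J = {..Suc m}"
  \<comment> \<open>Category \<open>m\<close> collects the retained atoms outside all \<open>A j\<close>, category \<open>m + 1\<close> the discarded
    atoms; \<open>b' j\<close> is the mark that the atoms of category \<open>j\<close> carry.\<close>
  define A' where "A' j = (if j < m then A j else if j = m then space S - (\<Union>i<m. A i) else space S)" for j
  define b' where "b' j \<longleftrightarrow> j \<le> m" for j
  have A'[measurable]: "A' j \<in> sets S" for j
    using A by (auto simp: A'_def)
  have unique: "\<exists>!j. j \<in> J \<and> Q i \<omega> \<in> A' j \<and> C i \<omega> = b' j" if \<omega>: "\<omega> \<in> space P" for i \<omega>
  proof -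
    have Q: "Q i \<omega> \<in> space S" using \<omega> by (rule measurable_space[OF Q_measurable])
    have "j = j'" if "j \<le> m" "j' \<le> m" "Q i \<omega> \<in> A' j" "Q i \<omega> \<in> A' j'" for j j'
    proof (rule ccontr)
      assume "j \<noteq> j'"
      then show False
        using that disj by (auto simp: A'_def disjoint_family_on_def split: if_splits)
    qed
    moreover have "\<exists>j\<le>m. Q i \<omega> \<in> A' j"
    proof (cases "\<exists>j<m. Q i \<omega> \<in> A j")
      case True
      then obtain j where "j < m" "Q i \<omega> \<in> A j" by blast
      then show ?thesis by (intro exI[of _ j]) (auto simp: A'_def)
    next
      case False
      then show ?thesis using Q by (intro exI[of _ m]) (auto simp: A'_def)
    qed
    moreover have "Q i \<omega> \<in> A' (Suc m)" using Q by (simp add: A'_def)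
    ultimately show ?thesis
      by (cases "C i \<omega>") (auto simp: J_def b'_def le_Suc_eq intro!: ex_ex1I)
  qed
  define T where "T i \<omega> = (THE j. j \<in> J \<and> Q i \<omega> \<in> A' j \<and> C i \<omega> = b' j)" for i \<omega>
  have T_iff: "T i \<omega> = j \<longleftrightarrow> j \<in> J \<and> Q i \<omega> \<in> A' j \<and> C i \<omega> = b' j" if "\<omega> \<in> space P" for i \<omega> j
    using theI'[OF unique[OF that, of i]] unique[OF that, of i] unfolding T_def[symmetric] by blast
  have T_J: "T i \<omega> \<in> J" if "\<omega> \<in> space P" for i \<omega>
    using T_iff[OF that, of i "T i \<omega>"] by simp
  have T[measurable]: "T i \<in> P \<rightarrow>\<^sub>M count_space UNIV" for i
  proof (subst measurable_count_space_eq2_countable; safe?)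
    fix j
    have "T i -` {j} \<inter> space P = {\<omega>\<in>space P. j \<in> J \<and> Q i \<omega> \<in> A' j \<and> C i \<omega> = b' j}"
      using T_iff by blast
    also have "\<dots> \<in> sets P" by measurable
    finally show "T i -` {j} \<inter> space P \<in> sets P" .
  qed auto

  define p where "p j = measure (\<kappa> (b' j)) (A' j)" for j
  have sum_p: "(\<Sum>j\<in>J. p j) = 1"
  proof -
    have disj': "disjoint_family_on A' {..m}"
      using disj by (auto simp: A'_def disjoint_family_on_def)
    have "(\<Union>j\<in>{..m}. A' j) = space S"
    proof
      show "(\<Union>j\<in>{..m}. A' j) \<subseteq> space S" using A'[THEN sets.sets_into_space] by blast
      show "space S \<subseteq> (\<Union>j\<in>{..m}. A' j)"
      proof
        fix q assume q: "q \<in> space S"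
        show "q \<in> (\<Union>j\<in>{..m}. A' j)"
        proof (cases "\<exists>j<m. q \<in> A j")
          case True
          then obtain j where "j < m" "q \<in> A j" by blast
          then show ?thesis by (intro UN_I[of j]) (auto simp: A'_def)
        next
          case False
          then show ?thesis using q by (intro UN_I[of m]) (auto simp: A'_def)
        qed
      qed
    qed
    then have "measure (\<kappa> True) (space S) = (\<Sum>j\<le>m. measure (\<kappa> True) (A' j))"
      using \<kappa>.finite_measure_finite_Union[of "{..m}" A' True] disj' A' by (simp add: image_subset_iff)
    then show ?thesis
      using total_\<kappa> by (simp add: J_def p_def b'_def A'_def)
  qed
  define K where "K j \<omega> = card {i. i < N \<omega> \<and> T i \<omega> = j}" for j \<omega>
  have [measurable]: "K j \<in> P \<rightarrow>\<^sub>M count_space UNIV" for j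
  proof -
    have "(\<lambda>\<omega>. \<Sum>i<N \<omega>. of_bool (T i \<omega> = j) :: nat) \<in> P \<rightarrow>\<^sub>M count_space UNIV"
      by (rule measurable_compose_countable[where f="\<lambda>n \<omega>. \<Sum>i<n. of_bool (T i \<omega> = j)"]) measurable
    also have "(\<lambda>\<omega>. \<Sum>i<N \<omega>. of_bool (T i \<omega> = j) :: nat) = K j"
      by (auto simp: K_def fun_eq_iff of_bool_def sum.If_cases Int_def)
    finally show ?thesis .
  qed
  have joint: "prob {\<omega>\<in>space P. \<forall>j\<in>J. K j \<omega> = k j} = (\<Prod>j\<in>J. pmf (poisson_law (r * p j)) (k j))" for k
    unfolding K_def
  proof (rule poisson_splitting)
    fix xs assume xs: "set xs \<subseteq> J"
    have "{\<omega>\<in>space P. N \<omega> = length xs \<and> (\<forall>i<length xs. T i \<omega> = xs ! i)} =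
        {\<omega>\<in>space P. N \<omega> = length xs \<and> (\<forall>i<length xs. Q i \<omega> \<in> A' (xs ! i) \<and> C i \<omega> = b' (xs ! i))}"
      using xs nth_mem[of _ xs] by (auto simp: T_iff subset_iff)
    then show "prob {\<omega>\<in>space P. N \<omega> = length xs \<and> (\<forall>i<length xs. T i \<omega> = xs ! i)} =
        pmf (poisson_law r) (length xs) * (\<Prod>i<length xs. p (xs ! i))"
      by (simp add: law p_def)
  qed (use r sum_p T_J in \<open>auto simp: J_def p_def\<close>)
  have J: "finite J" "J \<noteq> {}" by (auto simp: J_def)
  note K = indep_vars_nat_of_joint_pmf[OF J _ joint, simplified]
  have K_eq: "real (K j \<omega>) = measure (retained \<omega>) (A j)" if "j < m" "\<omega> \<in> space P" for j \<omega>
    using that A by (auto simp: retained_def measure_dirac_sum_of_bool K_def T_iff J_def A'_def b'_def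
        intro!: arg_cong[where f=card])
  have "{..<m} \<subseteq> J" by (auto simp: J_def)
  from indep_vars_subset[OF K(1) this]
  have "indep_vars (\<lambda>_. borel) (\<lambda>j \<omega>. real (K j \<omega>)) {..<m}"
    by (rule indep_vars_compose2) simp
  then show "indep_vars (\<lambda>_. borel) (\<lambda>j \<omega>. measure (retained \<omega>) (A j)) {..<m}"
    by (rule indep_vars_cong_on_space[OF prob_space_axioms, rotated]) (simp add: K_eq)
  show "distr P borel (\<lambda>\<omega>. measure (retained \<omega>) (A j)) = real_poisson_law (r * measure (\<kappa> True) (A j))"
    if j: "j < m"
  proof -
    have "distr P borel (\<lambda>\<omega>. measure (retained \<omega>) (A j)) = distr P borel (real \<circ> K j)"
      using j by (intro distr_cong) (auto simp: K_eq)
    also have "\<dots> = distr (distr P (count_space UNIV) (K j)) borel real"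
      by (intro distr_distr[symmetric]) auto
    also have "\<dots> = real_poisson_law (r * measure (\<kappa> True) (A j))"
      using j K(2)[of j] by (simp add: J_def real_poisson_law_def p_def b'_def A'_def)
    finally show ?thesis .
  qed
qed

lemma retained_poisson: "poisson_point_process P (scale_measure (ennreal r) (\<kappa> True)) retained"
proof -
  interpret \<kappa>: finite_measure "\<kappa> True" by (rule finite_\<kappa>)
  have "finite_measure (scale_measure (ennreal r) (\<kappa> True))"
    using r by (intro finite_measureI) (simp add: \<kappa>.emeasure_eq_measure ennreal_mult_eq_top_iff)
  moreover have "counting_algebra (scale_measure (ennreal r) (\<kappa> True)) = counting_algebra S"
    by (intro counting_algebra_cong) simp
  moreover have "indep_vars (\<lambda>_. borel) (\<lambda>j \<omega>. measure (retained \<omega>) (A j)) {..<m} \<and>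
      (\<forall>j<m. distr P borel (\<lambda>\<omega>. measure (retained \<omega>) (A j)) = real_poisson_law (r * measure (\<kappa> True) (A j)))"
    if "\<forall>j<m. A j \<in> sets S" "disjoint_family_on A {..<m}" for A :: "nat \<Rightarrow> 'a set" and m
    using retained_counts[of m A] that by blast
  ultimately show ?thesis
    using r unfolding poisson_point_process_def by (simp add: prob_space_axioms) blast
qed

text \<open>Once the number of atoms and all their marks are fixed, the atoms are still independent, and
  each retained one has law \<open>\<kappa> True\<close> normalized. Hence the retained process has the same conditional
  law on every pattern with \<open>k\<close> successes, whatever their positions and whatever the number of
  discarded atoms.\<close>

lemma retained_on_mark_pattern:
  fixes xs :: "bool list"
  defines "E \<equiv> {\<omega>\<in>space P. N \<omega> = length xs \<and> (\<forall>i<length xs. C i \<omega> = xs ! i)}"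
    and "\<tau> \<equiv> scale_measure (inverse (emeasure (\<kappa> True) (space S))) (\<kappa> True)"
  assumes k: "card {i. i < length xs \<and> xs ! i} = k"
    and pos: "0 < measure (\<kappa> True) (space S)"
    and G[measurable]: "G \<in> sets (counting_algebra S)"
  shows "emeasure P (E \<inter> retained -` G) = emeasure P E *
    emeasure (distr (\<Pi>\<^sub>M i\<in>{..<k}. \<tau>) (counting_algebra S) (\<lambda>q. dirac_sum S k (\<lambda>i. 1) q)) G"
proof (cases "prob E = 0")
  case True
  have [measurable]: "E \<in> sets P" unfolding E_def by measurable
  have "emeasure P (E \<inter> retained -` G) \<le> emeasure P E"
    by (intro emeasure_mono) auto
  then show ?thesis using True by (simp add: emeasure_eq_measure)
next
  case False
  interpret \<kappa>: finite_measure "\<kappa> b" for b by (rule finite_\<kappa>)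
  define n where "n = length xs"
  have [measurable]: "E \<in> sets P" unfolding E_def by measurable
  define U where "U = uniform_measure P E"
  interpret U: prob_space U
    unfolding U_def using False by (intro prob_space_uniform_measure) (auto simp: emeasure_eq_measure)
  have sets_U[measurable_cong, simp]: "sets U = sets P" by (simp add: U_def)
  have space_U[simp]: "space U = space P" by (simp add: U_def)
  define \<kappa>1 where "\<kappa>1 = measure (\<kappa> True) (space S)"
  have emeasure_\<tau>: "emeasure \<tau> A = ennreal (measure (\<kappa> True) A / \<kappa>1)" for A
    using pos by (simp add: \<tau>_def \<kappa>1_def \<kappa>.emeasure_eq_measure inverse_ennreal divide_inverse mult.commute
        flip: ennreal_mult)
  have sets_\<tau>[simp, measurable_cong]: "sets \<tau> = sets S" by (simp add: \<tau>_def)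
  interpret \<tau>: prob_space \<tau>
  proof
    have "space \<tau> = space S" by (rule sets_eq_imp_space_eq) simp
    then show "emeasure \<tau> (space \<tau>) = 1" using pos by (simp add: emeasure_\<tau> \<kappa>1_def)
  qed
  interpret prod_\<tau>: product_prob_space "\<lambda>_::nat. \<tau>" "{..<k}"
    by (intro product_prob_spaceI \<tau>.prob_space_axioms)

  obtain e where e: "bij_betw e {..<k} {i. i < n \<and> xs ! i}"
    using ex_bij_betw_nat_finite[of "{i. i < n \<and> xs ! i}"] k by (auto simp: n_def atLeast0LessThan)
  define X where "X \<omega> = (\<lambda>j\<in>{..<k}. Q (e j) \<omega>)" for \<omega>
  have X[measurable]: "X \<in> U \<rightarrow>\<^sub>M (\<Pi>\<^sub>M i\<in>{..<k}. \<tau>)"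
    unfolding X_def by measurable
  have X_law: "distr U (\<Pi>\<^sub>M i\<in>{..<k}. \<tau>) X = (\<Pi>\<^sub>M i\<in>{..<k}. \<tau>)"
  proof (rule prod_\<tau>.PiM_eqI)
    fix A assume "\<And>i. i \<in> {..<k} \<Longrightarrow> A i \<in> sets \<tau>"
    then have A: "\<And>j. j < k \<Longrightarrow> A j \<in> sets S" by simp
    \<comment> \<open>The conditions on the retained atoms, moved back to the original numbering; the discarded
      atoms are unconstrained.\<close>
    define A' where "A' i = (if i < n \<and> xs ! i then A (the_inv_into {..<k} e i) else space S)" for i
    have inv: "the_inv_into {..<k} e i < k" if "i < n" "xs ! i" for i
      using bij_betw_apply[OF bij_betw_the_inv_into[OF e], of i] that by simp
    have A': "A' i \<in> sets S" for i
      using A inv by (auto simp: A'_def)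
    have A'_e: "A' (e j) = A j" if "j < k" for j
      using bij_betw_apply[OF e, of j] that the_inv_into_f_f[of e "{..<k}" j] e
      by (auto simp: A'_def bij_betw_def)
    have split: "(\<Prod>i<n. measure (\<kappa> (xs ! i)) (B i)) =
        (\<Prod>j<k. measure (\<kappa> True) (B (e j))) * (\<Prod>i\<in>{i. i < n \<and> \<not> xs ! i}. measure (\<kappa> False) (B i))" for B
    proof -
      have "(\<Prod>i<n. measure (\<kappa> (xs ! i)) (B i)) =
          (\<Prod>i\<in>{i. i < n \<and> xs ! i} \<union> {i. i < n \<and> \<not> xs ! i}. measure (\<kappa> (xs ! i)) (B i))"
        by (intro prod.cong) auto
      also have "\<dots> = (\<Prod>i\<in>{i. i < n \<and> xs ! i}. measure (\<kappa> True) (B i)) *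
          (\<Prod>i\<in>{i. i < n \<and> \<not> xs ! i}. measure (\<kappa> False) (B i))"
        by (subst prod.union_disjoint) auto
      also have "(\<Prod>i\<in>{i. i < n \<and> xs ! i}. measure (\<kappa> True) (B i)) = (\<Prod>j<k. measure (\<kappa> True) (B (e j)))"
        using e by (rule prod.reindex_bij_betw[symmetric])
      finally show ?thesis .
    qed
    \<comment> \<open>The factors that do not involve \<open>A\<close>, which cancel in the conditional probability.\<close>
    define c where "c = pmf (poisson_law r) n * (\<Prod>i\<in>{i. i < n \<and> \<not> xs ! i}. measure (\<kappa> False) (space S))"
    have prob_E: "prob E = c * \<kappa>1 ^ k"
    proof -
      have "E = {\<omega>\<in>space P. N \<omega> = n \<and> (\<forall>i<n. Q i \<omega> \<in> space S \<and> C i \<omega> = xs ! i)}"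
        using measurable_space[OF Q_measurable] by (auto simp: E_def n_def)
      then show ?thesis
        using law[of "\<lambda>_. space S" n "\<lambda>i. xs ! i"] by (simp add: split c_def \<kappa>1_def)
    qed
    have "E \<inter> X -` Pi\<^sub>E {..<k} A = {\<omega>\<in>space P. N \<omega> = n \<and> (\<forall>i<n. Q i \<omega> \<in> A' i \<and> C i \<omega> = xs ! i)}"
    proof (intro set_eqI iffI)
      fix \<omega> assume \<omega>: "\<omega> \<in> E \<inter> X -` Pi\<^sub>E {..<k} A"
      have "Q i \<omega> \<in> A' i" if i: "i < n" for i
      proof (cases "xs ! i")
        case True
        then obtain j where "j < k" "i = e j"
          using e i by (auto simp: bij_betw_def)
        then show ?thesis using \<omega> by (auto simp: A'_e X_def)
      next
        case False
        then show ?thesis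
          using \<omega> measurable_space[OF Q_measurable, of \<omega> i] by (auto simp: A'_def E_def)
      qed
      then show "\<omega> \<in> {\<omega>\<in>space P. N \<omega> = n \<and> (\<forall>i<n. Q i \<omega> \<in> A' i \<and> C i \<omega> = xs ! i)}"
        using \<omega> by (auto simp: E_def n_def)
    next
      fix \<omega> assume \<omega>: "\<omega> \<in> {\<omega>\<in>space P. N \<omega> = n \<and> (\<forall>i<n. Q i \<omega> \<in> A' i \<and> C i \<omega> = xs ! i)}"
      have "Q (e j) \<omega> \<in> A j" if "j < k" for j
        using \<omega> bij_betw_apply[OF e, of j] that A'_e[OF that] by auto
      then show "\<omega> \<in> E \<inter> X -` Pi\<^sub>E {..<k} A"
        using \<omega> by (auto simp: E_def n_def X_def)
    qed
    then have prob_EX: "prob (E \<inter> X -` Pi\<^sub>E {..<k} A) = c * (\<Prod>j<k. measure (\<kappa> True) (A j))"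
      by (simp add: law A' split A'_e c_def) (simp add: A'_def)
    have "emeasure (distr U (\<Pi>\<^sub>M i\<in>{..<k}. \<tau>) X) (Pi\<^sub>E {..<k} A) =
        emeasure P (E \<inter> X -` Pi\<^sub>E {..<k} A) / emeasure P E"
    proof -
      have [measurable]: "Pi\<^sub>E {..<k} A \<in> sets (\<Pi>\<^sub>M i\<in>{..<k}. \<tau>)"
        using A by (intro sets_PiM_I_finite) auto
      have "X -` Pi\<^sub>E {..<k} A \<inter> space U \<in> sets U" by measurable
      moreover have "E \<inter> (X -` Pi\<^sub>E {..<k} A \<inter> space P) = E \<inter> X -` Pi\<^sub>E {..<k} A"
        by (auto simp: E_def)
      ultimately show ?thesis
        by (subst emeasure_distr) (simp_all add: U_def)
    qed
    also have "\<dots> = ennreal (prob (E \<inter> X -` Pi\<^sub>E {..<k} A) / prob E)"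
      unfolding emeasure_eq_measure using False by (intro divide_ennreal) (simp_all add: less_le)
    also have "\<dots> = ennreal ((c * (\<Prod>j<k. measure (\<kappa> True) (A j))) / (c * \<kappa>1 ^ k))"
      by (simp only: prob_EX prob_E)
    also have "\<dots> = ennreal (\<Prod>j<k. measure (\<kappa> True) (A j) / \<kappa>1)"
      using False by (simp add: prob_E prod_dividef)
    also have "\<dots> = (\<Prod>j<k. emeasure \<tau> (A j))"
      using pos by (simp add: emeasure_\<tau> prod_ennreal \<kappa>1_def)
    finally show "emeasure (distr U (\<Pi>\<^sub>M i\<in>{..<k}. \<tau>) X) (Pi\<^sub>E {..<k} A) = (\<Prod>j<k. emeasure \<tau> (A j))" .
  qed simp_all

  have ds[measurable]: "(\<lambda>q. dirac_sum S k (\<lambda>i. 1) q) \<in> (\<Pi>\<^sub>M i\<in>{..<k}. \<tau>) \<rightarrow>\<^sub>M counting_algebra S"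
  proof -
    have "sets (\<Pi>\<^sub>M i\<in>{..<k}. \<tau>) = sets (\<Pi>\<^sub>M i\<in>{..<k}. S)" by (intro sets_PiM_cong) simp_all
    then show ?thesis using measurable_dirac_sum_PiM[of S k] by (simp cong: measurable_cong_sets)
  qed
  have ret_eq: "retained \<omega> = dirac_sum S k (\<lambda>i. 1) (X \<omega>)" if "\<omega> \<in> E" for \<omega>
  proof -
    have "retained \<omega> = dirac_sum S n (\<lambda>i. of_bool (xs ! i)) (\<lambda>i. Q i \<omega>)"
      using that by (auto simp: retained_def E_def n_def dirac_sum_def)
    also have "\<dots> = dirac_sum S k (\<lambda>i. 1) (\<lambda>j. Q (e j) \<omega>)"
      using e by (rule dirac_sum_of_bool_reindex)
    also have "\<dots> = dirac_sum S k (\<lambda>i. 1) (X \<omega>)"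
      by (simp add: dirac_sum_def X_def)
    finally show ?thesis .
  qed
  have "emeasure (distr (\<Pi>\<^sub>M i\<in>{..<k}. \<tau>) (counting_algebra S) (\<lambda>q. dirac_sum S k (\<lambda>i. 1) q)) G =
      emeasure (distr (distr U (\<Pi>\<^sub>M i\<in>{..<k}. \<tau>) X) (counting_algebra S) (\<lambda>q. dirac_sum S k (\<lambda>i. 1) q)) G"
    by (simp add: X_law)
  also have "\<dots> = emeasure U ((\<lambda>\<omega>. dirac_sum S k (\<lambda>i. 1) (X \<omega>)) -` G \<inter> space P)"
    by (subst distr_distr[OF ds X]) (auto simp: emeasure_distr comp_def)
  also have "\<dots> = emeasure P (E \<inter> ((\<lambda>\<omega>. dirac_sum S k (\<lambda>i. 1) (X \<omega>)) -` G \<inter> space P)) / emeasure P E"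
  proof -
    have "(\<lambda>\<omega>. dirac_sum S k (\<lambda>i. 1) (X \<omega>)) -` G \<inter> space U \<in> sets U" by measurable
    then show ?thesis by (simp add: U_def)
  qed
  also have "E \<inter> ((\<lambda>\<omega>. dirac_sum S k (\<lambda>i. 1) (X \<omega>)) -` G \<inter> space P) = E \<inter> retained -` G"
    by (auto simp: ret_eq) (auto simp: E_def)
  finally have "emeasure (distr (\<Pi>\<^sub>M i\<in>{..<k}. \<tau>) (counting_algebra S) (\<lambda>q. dirac_sum S k (\<lambda>i. 1) q)) G =
      emeasure P (E \<inter> retained -` G) / emeasure P E" .
  then show ?thesis
    using False ennreal_mult_divide_eq[of "emeasure P E" "emeasure P (E \<inter> retained -` G)"]
    by (simp add: emeasure_eq_measure ennreal_times_divide mult.commute)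
qed

text \<open>The event that \<open>k\<close> atoms are retained is the disjoint union of countably many mark patterns,
  encoded as Boolean lists. The conditional law given each of them is the same, so it is also the
  conditional law given the union. Conditioning is meaningful because the number of retained
  atoms is Poisson with positive mean.\<close>

lemma retained_given_count:
  defines "B \<equiv> \<lambda>k::nat. {\<omega>\<in>space P. measure (retained \<omega>) (space S) = real k}"
    and "\<tau> \<equiv> scale_measure (inverse (emeasure (\<kappa> True) (space S))) (\<kappa> True)"
  assumes pos: "0 < measure (\<kappa> True) (space S)"
  shows "distr (uniform_measure P (B k)) (counting_algebra S) retained =
    distr (\<Pi>\<^sub>M i\<in>{..<k}. \<tau>) (counting_algebra S) (\<lambda>q. dirac_sum S k (\<lambda>i. 1) q)"
proof (rule measure_eqI)
  fix G assume "G \<in> sets (distr (uniform_measure P (B k)) (counting_algebra S) retained)"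
  then have G[measurable]: "G \<in> sets (counting_algebra S)" by simp
  let ?\<nu> = "distr (\<Pi>\<^sub>M i\<in>{..<k}. \<tau>) (counting_algebra S) (\<lambda>q. dirac_sum S k (\<lambda>i. 1) q)"
  define E where "E xs = {\<omega>\<in>space P. N \<omega> = length xs \<and> (\<forall>i<length xs. C i \<omega> = xs ! i)}" for xs :: "bool list"
  define I where "I = {xs :: bool list. card {i. i < length xs \<and> xs ! i} = k}"
  have [measurable]: "E xs \<in> sets P" for xs unfolding E_def by measurable
  have ret_G: "retained -` G \<inter> space P \<in> sets P" by measurable
  have disj: "disjoint_family_on E I"
    by (auto simp: disjoint_family_on_def E_def intro!: nth_equalityI)
  have B_eq: "B k = (\<Union>xs\<in>I. E xs)"
  proof (intro set_eqI iffI)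
    fix \<omega> assume \<omega>: "\<omega> \<in> B k"
    define xs where "xs = map (\<lambda>i. C i \<omega>) [0..<N \<omega>]"
    have "card {i. i < N \<omega> \<and> C i \<omega>} = k"
    proof -
      have "card {i. i < N \<omega> \<and> C i \<omega>} = card {i. i < N \<omega> \<and> C i \<omega> \<and> Q i \<omega> \<in> space S}"
        using \<omega> measurable_space[OF Q_measurable] by (intro arg_cong[where f=card]) (auto simp: B_def)
      then show ?thesis
        using \<omega> by (simp add: B_def retained_def measure_dirac_sum_of_bool)
    qed
    moreover have "{i. i < length xs \<and> xs ! i} = {i. i < N \<omega> \<and> C i \<omega>}"
      by (auto simp: xs_def)
    ultimately have "xs \<in> I" by (simp add: I_def)
    moreover have "\<omega> \<in> E xs" using \<omega> by (auto simp: E_def xs_def B_def)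
    ultimately show "\<omega> \<in> (\<Union>xs\<in>I. E xs)" by blast
  next
    fix \<omega> assume "\<omega> \<in> (\<Union>xs\<in>I. E xs)"
    then obtain xs where xs: "xs \<in> I" "\<omega> \<in> E xs" by blast
    have "card {i. i < N \<omega> \<and> C i \<omega> \<and> Q i \<omega> \<in> space S} = card {i. i < length xs \<and> xs ! i}"
      using xs(2) measurable_space[OF Q_measurable] by (intro arg_cong[where f=card]) (auto simp: E_def)
    then show "\<omega> \<in> B k"
      using xs by (auto simp: I_def B_def E_def retained_def measure_dirac_sum_of_bool)
  qed
  have [measurable]: "B k \<in> sets P"
    unfolding B_eq by measurable
  have B_pos: "0 < prob (B k)"
  proof -
    have *: "(\<lambda>\<omega>. measure (retained \<omega>) (space S)) \<in> borel_measurable P"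
      using measurable_measure_counting_algebra by (rule measurable_compose[OF measurable_retained]) simp
    have "prob (B k) = measure (distr P borel (\<lambda>\<omega>. measure (retained \<omega>) (space S))) {real k}"
      by (subst measure_distr[OF *]) (auto simp: B_def intro!: arg_cong[where f=prob])
    also have "\<dots> = measure (real_poisson_law (r * measure (\<kappa> True) (space S))) {real k}"
      using retained_counts(2)[of 1 "\<lambda>_. space S" 0] by (simp add: disjoint_family_on_def)
    also have "\<dots> = pmf (poisson_law (r * measure (\<kappa> True) (space S))) k"
      unfolding real_poisson_law_def
      by (subst measure_distr) (auto simp: vimage_def pmf.rep_eq)
    also have "\<dots> > 0" using r pos by (simp add: pmf_poisson_law)
    finally show ?thesis .
  qed
  have "emeasure P (B k \<inter> retained -` G) = emeasure P (\<Union>xs\<in>I. E xs \<inter> (retained -` G \<inter> space P))"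
    unfolding B_eq by (intro arg_cong[where f="emeasure P"]) (auto simp: E_def)
  also have "\<dots> = (\<integral>\<^sup>+xs. emeasure P (E xs \<inter> (retained -` G \<inter> space P)) \<partial>count_space I)"
    using disj ret_G by (intro emeasure_UN_countable) (auto simp: disjoint_family_on_def)
  also have "\<dots> = (\<integral>\<^sup>+xs. emeasure P (E xs) * emeasure ?\<nu> G \<partial>count_space I)"
  proof (intro nn_integral_cong)
    fix xs assume xs: "xs \<in> space (count_space I)"
    have "E xs \<inter> (retained -` G \<inter> space P) = E xs \<inter> retained -` G" by (auto simp: E_def)
    then show "emeasure P (E xs \<inter> (retained -` G \<inter> space P)) = emeasure P (E xs) * emeasure ?\<nu> G"
      using retained_on_mark_pattern[OF _ pos G, of xs k] xs by (simp add: E_def I_def \<tau>_def)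
  qed
  also have "\<dots> = (\<integral>\<^sup>+xs. emeasure P (E xs) \<partial>count_space I) * emeasure ?\<nu> G"
    by (intro nn_integral_multc) simp
  also have "(\<integral>\<^sup>+xs. emeasure P (E xs) \<partial>count_space I) = emeasure P (B k)"
    unfolding B_eq using disj by (intro emeasure_UN_countable[symmetric]) auto
  finally have *: "emeasure P (B k \<inter> retained -` G) = emeasure P (B k) * emeasure ?\<nu> G" .
  have "B k \<inter> (retained -` G \<inter> space P) = B k \<inter> retained -` G" by (auto simp: B_def)
  then have "emeasure (distr (uniform_measure P (B k)) (counting_algebra S) retained) G =
      emeasure P (B k \<inter> retained -` G) / emeasure P (B k)"
    using ret_G by (subst emeasure_distr) (auto cong: measurable_cong_sets)
  also have "\<dots> = emeasure ?\<nu> G"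
    unfolding * using B_pos
    by (subst mult.commute, subst ennreal_mult_divide_eq) (simp_all add: emeasure_eq_measure)
  finally show "emeasure (distr (uniform_measure P (B k)) (counting_algebra S) retained) G = emeasure ?\<nu> G" .
qed simp

end

section \<open>Thinning by a likelihood coin\<close>

theorem theorem2p2:
  fixes \<mu>\<^sub>0 :: "'a measure" and L :: "'a \<Rightarrow> 'y \<Rightarrow> real" and y :: 'y
    and c \<gamma> :: real and coin :: "'a \<Rightarrow> bool pmf"
    and P :: "'w measure" and M :: "'w \<Rightarrow> nat" and Q :: "nat \<Rightarrow> 'w \<Rightarrow> 'a"
    and C :: "nat \<Rightarrow> 'w \<Rightarrow> bool" and \<Xi> \<eta> :: "'w \<Rightarrow> 'a measure" and N :: "'w \<Rightarrow> real"
  assumes prior: "prob_space \<mu>\<^sub>0"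
    and L_meas: "(\<lambda>q. L q y) \<in> borel_measurable \<mu>\<^sub>0"
    and L_range: "\<And>q. q \<in> space \<mu>\<^sub>0 \<Longrightarrow> 0 \<le> L q y \<and> L q y \<le> 1"
    and L_integrable: "integrable \<mu>\<^sub>0 (\<lambda>q. L q y)"
    and evidence_pos: "0 < evidence \<mu>\<^sub>0 L y"
    and scaled_coin: "scaled_coin_oracle \<mu>\<^sub>0 c (\<lambda>q. L q y) coin"
    and \<gamma>: "0 < \<gamma>"
    and prob: "prob_space P"
    and \<Xi>_sum: "\<And>\<omega>. \<omega> \<in> space P \<Longrightarrow> \<Xi> \<omega> = dirac_sum \<mu>\<^sub>0 (M \<omega>) (\<lambda>i. 1) (\<lambda>i. Q i \<omega>)"
    and \<Xi>_poisson: "poisson_point_process P (scale_measure (ennreal (\<gamma> / c)) \<mu>\<^sub>0) \<Xi>"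
    and \<Xi>_atoms: "poisson_atoms P (scale_measure (ennreal (\<gamma> / c)) \<mu>\<^sub>0) M Q"
    and marks: "independent_queries P \<mu>\<^sub>0 M Q coin C"
    and \<eta>: "\<And>\<omega>. \<omega> \<in> space P \<Longrightarrow>
              \<eta> \<omega> = dirac_sum \<mu>\<^sub>0 (M \<omega>) (\<lambda>i. of_bool (C i \<omega>)) (\<lambda>i. Q i \<omega>)"
    and N: "\<And>\<omega>. \<omega> \<in> space P \<Longrightarrow> N \<omega> = measure (\<eta> \<omega>) (space \<mu>\<^sub>0)"
  shows "poisson_point_process P
           (scale_measure (ennreal \<gamma>) (unnormalized_posterior \<mu>\<^sub>0 L y)) \<eta>
    \<and> distr P borel N = real_poisson_law (\<gamma> * evidence \<mu>\<^sub>0 L y)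
    \<and> (\<forall>k::nat. 1 \<le> k \<longrightarrow>
         distr (uniform_measure P {\<omega>\<in>space P. N \<omega> = real k}) (counting_algebra \<mu>\<^sub>0) \<eta>
         = distr (\<Pi>\<^sub>M i\<in>{..<k}. posterior \<mu>\<^sub>0 L y) (counting_algebra \<mu>\<^sub>0)
             (\<lambda>q. dirac_sum \<mu>\<^sub>0 k (\<lambda>i. 1) q))
    \<and> prob_space.expectation P (\<lambda>\<omega>. N \<omega> / \<gamma>) = evidence \<mu>\<^sub>0 L y
    \<and> prob_space.variance P (\<lambda>\<omega>. N \<omega> / \<gamma>) = evidence \<mu>\<^sub>0 L y / \<gamma>"
proof (intro conjI allI impI)
  interpret prior: prob_space \<mu>\<^sub>0 by (rule prior)
  interpret prob_space P by (rule prob)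
  note [measurable] = L_meas
  define \<nu> where "\<nu> = unnormalized_posterior \<mu>\<^sub>0 L y"
  define Z where "Z = evidence \<mu>\<^sub>0 L y"
  define \<kappa> where "\<kappa> b = density \<mu>\<^sub>0 (\<lambda>q. ennreal (pmf (coin q) b))" for b
  have Z: "0 < Z" using evidence_pos by (simp add: Z_def)
  have c: "0 < c" "c \<le> 1" and coin: "\<And>q. q \<in> space \<mu>\<^sub>0 \<Longrightarrow> coin q = bernoulli_pmf (c * L q y)"
    using scaled_coin by (auto simp: scaled_coin_oracle_def)
  have pmf_coin: "pmf (coin q) True = c * L q y" "pmf (coin q) False = 1 - c * L q y"
    if "q \<in> space \<mu>\<^sub>0" for q
    using L_range[OF that] c by (simp_all add: coin[OF that] mult_le_one)
  have coin_meas[measurable]: "(\<lambda>q. pmf (coin q) b) \<in> borel_measurable \<mu>\<^sub>0" for b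
    by (cases b) (simp_all add: pmf_coin cong: measurable_cong)
  have measure_\<nu>: "measure \<nu> (space \<mu>\<^sub>0) = Z"
  proof -
    have "measure \<nu> (space \<mu>\<^sub>0) = enn2real (\<integral>\<^sup>+q. ennreal (L q y) \<partial>\<mu>\<^sub>0)"
      by (simp add: \<nu>_def unnormalized_posterior_def measure_def emeasure_density cong: nn_integral_cong)
    also have "\<dots> = Z"
      unfolding Z_def evidence_def
      using L_range by (intro integral_eq_nn_integral[symmetric]) auto
    finally show ?thesis .
  qed
  have \<kappa>_True: "\<kappa> True = scale_measure (ennreal c) \<nu>"
  proof -
    have "\<kappa> True = density \<mu>\<^sub>0 (\<lambda>q. ennreal (c * L q y))"
      unfolding \<kappa>_def by (intro density_cong AE_I2) (simp_all add: pmf_coin)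
    also have "\<dots> = scale_measure (ennreal c) \<nu>"
      unfolding \<nu>_def unnormalized_posterior_def using L_range c by (intro density_cmult) auto
    finally show ?thesis .
  qed
  have measure_\<kappa>: "measure (\<kappa> b) (space \<mu>\<^sub>0) = (\<integral>q. pmf (coin q) b \<partial>\<mu>\<^sub>0)" for b
    unfolding \<kappa>_def by (simp add: measure_density_eq_integral cong: Bochner_Integration.integral_cong)

  interpret marked_poisson_atoms P \<mu>\<^sub>0 "\<gamma> / c" \<kappa> M Q C
  proof (intro marked_poisson_atoms.intro marked_poisson_atoms_axioms.intro prob)
    show "0 < \<gamma> / c" using \<gamma> c by simp
    show "M \<in> P \<rightarrow>\<^sub>M count_space UNIV" "\<And>i. C i \<in> P \<rightarrow>\<^sub>M count_space UNIV"
      using \<Xi>_atoms marks by (auto simp: poisson_atoms_def independent_queries_def)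
    show "\<And>i. Q i \<in> P \<rightarrow>\<^sub>M \<mu>\<^sub>0"
      using \<Xi>_atoms by (simp add: poisson_atoms_def cong: measurable_cong_sets)
    show "sets (\<kappa> b) = sets \<mu>\<^sub>0" for b by (simp add: \<kappa>_def)
    show "finite_measure (\<kappa> b)" for b
    proof (rule finite_measureI)
      have "emeasure (\<kappa> b) (space (\<kappa> b)) = (\<integral>\<^sup>+q. ennreal (pmf (coin q) b) \<partial>\<mu>\<^sub>0)"
        by (simp add: \<kappa>_def emeasure_density cong: nn_integral_cong)
      also have "\<dots> \<le> (\<integral>\<^sup>+q. 1 \<partial>\<mu>\<^sub>0)"
        by (intro nn_integral_mono) (simp add: pmf_le_1)
      also have "\<dots> = 1" by (simp add: prior.emeasure_space_1)
      finally show "emeasure (\<kappa> b) (space (\<kappa> b)) \<noteq> \<infinity>" by (auto simp: top_unique)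
    qed
    show "measure (\<kappa> True) (space \<mu>\<^sub>0) + measure (\<kappa> False) (space \<mu>\<^sub>0) = 1"
    proof -
      have "(\<integral>q. pmf (coin q) True \<partial>\<mu>\<^sub>0) + (\<integral>q. pmf (coin q) False \<partial>\<mu>\<^sub>0) =
          (\<integral>q. pmf (coin q) True + pmf (coin q) False \<partial>\<mu>\<^sub>0)"
        by (intro Bochner_Integration.integral_add[symmetric] prior.integrable_const_bound[where B=1])
           (auto simp: pmf_le_1)
      also have "\<dots> = (\<integral>q. 1 \<partial>\<mu>\<^sub>0)"
        by (intro Bochner_Integration.integral_cong) (simp_all add: pmf_coin)
      finally show ?thesis by (simp add: measure_\<kappa> prior.prob_space)
    qed
    show "prob {\<omega>\<in>space P. M \<omega> = n \<and> (\<forall>i<n. Q i \<omega> \<in> A i \<and> C i \<omega> = b i)} =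
        pmf (poisson_law (\<gamma> / c)) n * (\<Prod>i<n. measure (\<kappa> (b i)) (A i))"
      if "\<And>i. A i \<in> sets \<mu>\<^sub>0" for n A b
      unfolding \<kappa>_def
      by (rule marked_atoms_law[OF prior _ coin_meas \<Xi>_atoms marks that]) (use \<gamma> c in simp)
  qed

  have \<eta>_eq: "\<eta> \<omega> = retained \<omega>" if "\<omega> \<in> space P" for \<omega>
    using \<eta>[OF that] by (simp add: retained_def)
  have N_eq: "N \<omega> = measure (retained \<omega>) (space \<mu>\<^sub>0)" if "\<omega> \<in> space P" for \<omega>
    using N[OF that] by (simp add: \<eta>_eq that)
  have intensity: "scale_measure (ennreal (\<gamma> / c)) (\<kappa> True) = scale_measure (ennreal \<gamma>) \<nu>"
    unfolding \<kappa>_True using \<gamma> c by (simp flip: ennreal_mult)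
  have \<kappa>_space: "measure (\<kappa> True) (space \<mu>\<^sub>0) = c * Z"
    using c by (simp add: \<kappa>_True measure_\<nu>)

  show "poisson_point_process P (scale_measure (ennreal \<gamma>) (unnormalized_posterior \<mu>\<^sub>0 L y)) \<eta>"
    using retained_poisson unfolding intensity \<nu>_def
    by (rule poisson_point_process_cong) (simp add: \<eta>_eq)

  have N_meas: "N \<in> borel_measurable P"
  proof -
    have "(\<lambda>\<omega>. measure (retained \<omega>) (space \<mu>\<^sub>0)) \<in> borel_measurable P"
      using measurable_measure_counting_algebra by (rule measurable_compose[OF measurable_retained]) simp
    then show ?thesis by (simp add: N_eq cong: measurable_cong)
  qed
  show N_law: "distr P borel N = real_poisson_law (\<gamma> * evidence \<mu>\<^sub>0 L y)"
  proof -
    have "distr P borel N = distr P borel (\<lambda>\<omega>. measure (retained \<omega>) (space \<mu>\<^sub>0))"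
      by (intro distr_cong) (simp_all add: N_eq)
    also have "\<dots> = real_poisson_law (\<gamma> / c * (c * Z))"
      using retained_counts(2)[of 1 "\<lambda>_. space \<mu>\<^sub>0" 0] by (simp add: disjoint_family_on_def \<kappa>_space)
    finally show ?thesis using c by (simp add: Z_def)
  qed

  show "distr (uniform_measure P {\<omega>\<in>space P. N \<omega> = real k}) (counting_algebra \<mu>\<^sub>0) \<eta> =
      distr (\<Pi>\<^sub>M i\<in>{..<k}. posterior \<mu>\<^sub>0 L y) (counting_algebra \<mu>\<^sub>0) (\<lambda>q. dirac_sum \<mu>\<^sub>0 k (\<lambda>i. 1) q)"
    for k
  proof -
    have "{\<omega>\<in>space P. N \<omega> = real k} = {\<omega>\<in>space P. measure (retained \<omega>) (space \<mu>\<^sub>0) = real k}"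
      by (auto simp: N_eq)
    then have "distr (uniform_measure P {\<omega>\<in>space P. N \<omega> = real k}) (counting_algebra \<mu>\<^sub>0) \<eta> =
        distr (uniform_measure P {\<omega>\<in>space P. measure (retained \<omega>) (space \<mu>\<^sub>0) = real k})
          (counting_algebra \<mu>\<^sub>0) retained"
      by (intro distr_cong) (simp_all add: \<eta>_eq)
    moreover have "scale_measure (inverse (emeasure (\<kappa> True) (space \<mu>\<^sub>0))) (\<kappa> True) = posterior \<mu>\<^sub>0 L y"
    proof -
      interpret \<kappa>: finite_measure "\<kappa> True" by (rule finite_\<kappa>)
      have "scale_measure (inverse (emeasure (\<kappa> True) (space \<mu>\<^sub>0))) (\<kappa> True) = scale_measure (ennreal (1 / Z)) \<nu>"
        using c Z unfolding \<kappa>.emeasure_eq_measure \<kappa>_space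
        by (simp add: \<kappa>_True inverse_ennreal flip: ennreal_mult) (simp add: field_simps)
      also have "\<dots> = density \<mu>\<^sub>0 (\<lambda>q. ennreal (1 / Z * L q y))"
        unfolding \<nu>_def unnormalized_posterior_def using L_range Z by (intro density_cmult[symmetric]) auto
      finally show ?thesis by (simp add: posterior_def Z_def)
    qed
    ultimately show ?thesis
      using retained_given_count[of k] c Z by (simp add: \<kappa>_space)
  qed

  have mean: "expectation N = \<gamma> * Z" and var: "variance N = \<gamma> * Z"
    using poisson_mean_variance[OF N_meas N_law] \<gamma> Z by (simp_all add: Z_def)
  show mean': "expectation (\<lambda>\<omega>. N \<omega> / \<gamma>) = evidence \<mu>\<^sub>0 L y"
    using mean \<gamma> by (simp add: Z_def)
  have "variance (\<lambda>\<omega>. N \<omega> / \<gamma>) = expectation (\<lambda>\<omega>. (N \<omega> - \<gamma> * Z)\<^sup>2 / \<gamma>\<^sup>2)"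
    unfolding mean' using \<gamma> by (intro Bochner_Integration.integral_cong) (simp_all add: Z_def field_simps power2_eq_square)
  also have "\<dots> = variance N / \<gamma>\<^sup>2" by (simp add: mean)
  also have "\<dots> = evidence \<mu>\<^sub>0 L y / \<gamma>"
    unfolding var using \<gamma> by (simp add: Z_def power2_eq_square)
  finally show "variance (\<lambda>\<omega>. N \<omega> / \<gamma>) = evidence \<mu>\<^sub>0 L y / \<gamma>" .
qed

end
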